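(* Let $q$ be a power of an odd prime $p$ (so $p=\mathrm{char}\,\mathbb{F}_q$), let $r$ be an odd integer with $r>3$, and let $a\in\mathbb{F}_{q^2}^*$ satisfy $a^{q+1}\ne 1$. Let $f=X^r\bigl(a+X^{2(q-1)}\bigr)\in\mathbb{F}_{q^2}[X]$. Then $f$ is not a permutation polynomial of $\mathbb{F}_{q^2}$ provided \[ q\ge \begin{cases} r^2-4r+5&\text{if } r\equiv 3\pmod p,\\ 8r-15&\text{if } r\not\equiv 3\pmod p \text{ and either } p=3 \text{ or } r\equiv 7/4\pmod p,\\ 6r-11&\text{if } p>3 \text{ and } r\not\equiv 3,\ 7/4\pmod p. \end{cases} \]
   Context: A polynomial $f\in\mathbb{F}_{q^2}[X]$ is a permutation polynomial (PP) of $\mathbb{F}_{q^2}$ if the map $x\mapsto f(x)$ is a bijection of $\mathbb{F}_{q^2}$. The congruence $r\equiv 7/4\pmod p$ means $4r\equiv 7\pmod p$. *)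

theory Defs
  imports
    "HOL-Computational_Algebra.Polynomial"
    "HOL-Computational_Algebra.Primes"
    "HOL-Number_Theory.Cong"
    "HOL-Library.Cardinality"
begin

text \<open>The field is the whole type \<open>'a\<close>; the field with $q^2$ elements is a finite field type
  with \<^term>\<open>CARD('a) = q ^ 2\<close>.\<close>

definition permutation_polynomial :: "'a::{field, finite} poly \<Rightarrow> bool" where
  "permutation_polynomial f \<longleftrightarrow> bij (poly f)"

end

theory Submission
  imports Defs "HOL-Computational_Algebra.Formal_Power_Series"
begin

text \<open>
  Hermite's criterion: if $f$ permutes the field, then $\sum_x f(x)^{2n(q-1)} = 0$ for
  $0 < 2n < q + 1$. With $y = x^{2(q-1)}$, which satisfies $y^{q+1} = 1$, the summand is
  $y^{n(r-2)} ((a^q y + 1)/(y + a))^{2n}$. As long as $2n(r-2) < q + 1$, expanding the geometric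
  sums of $1/(y + a(1 + X))$ in a formal variable $X$ turns the power sum into a polynomial
  equation in $w = (-a)^{(q+1)/2}$ and $r$. Here $w^2 = a^{q+1} \neq 1$.

  For $n = 1$ the equation is $2(1 - w^2)(r - 3) = w(3w - 1)$, which determines $r$ in terms of $w$.
  Substituting this for $n = 2$ leaves $w(3w-1)(w^2-2w+5)(w^2+2w-1) = 0$ when $p > 3$. The first
  two factors correspond to $r \equiv 3$ and the third one to $4r \equiv 7$. The equation for
  $n = 3$ excludes the fourth factor, and also the third one unless $p = 181$, where $n = 4$ helps.
  If $p = 3 \nmid r$, then $n = 1, 2, 4$ suffice.
  If $r = 3 + p^e \cdot 2u$ with $p \nmid u$, then $n = (p^e + 1)/2$ yields $u \equiv 0$.
\<close>

subsection \<open>Prime characteristic and finite fields\<close>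

lemma freshman_dream_prime:
  fixes x y :: "'a::comm_semiring_1"
  assumes "prime p" "of_nat p = (0::'a)"
  shows "(x + y) ^ p = x ^ p + y ^ p"
proof -
  have p: "p > 1" using assms(1) prime_gt_1_nat by blast
  have "(x + y) ^ p = (\<Sum>j\<le>p. of_nat (p choose j) * x ^ j * y ^ (p - j))"
    by (simp add: binomial_ring)
  also have "\<dots> = (\<Sum>j\<in>{0, p}. of_nat (p choose j) * x ^ j * y ^ (p - j))"
  proof (rule sum.mono_neutral_right)
    show "\<forall>j\<in>{..p} - {0, p}. of_nat (p choose j) * x ^ j * y ^ (p - j) = 0"
    proof
      fix j assume "j \<in> {..p} - {0, p}"
      then have "p dvd (p choose j)"
        using dvd_choose_prime[of j p] assms(1) p by auto
      then have "of_nat (p choose j) = (0::'a)"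
        using assms(2) by (metis dvd_def mult_zero_left of_nat_mult)
      then show "of_nat (p choose j) * x ^ j * y ^ (p - j) = 0" by simp
    qed
  qed auto
  also have "\<dots> = x ^ p + y ^ p" using p by (simp add: add.commute)
  finally show ?thesis .
qed

lemma freshman_dream:
  fixes x y :: "'a::comm_semiring_1"
  assumes "prime p" "of_nat p = (0::'a)"
  shows "(x + y) ^ (p ^ e) = x ^ (p ^ e) + y ^ (p ^ e)"
  by (induction e) (simp_all add: power_mult freshman_dream_prime[OF assms] mult.commute[of p])

lemma fps_binomial_nth:
  fixes c e :: "'a::comm_ring_1"
  shows "fps_nth ((fps_const c + fps_const e * fps_X) ^ d) i = of_nat (d choose i) * c ^ (d - i) * e ^ i"
proof -
  have "(fps_const c + fps_const e * fps_X) ^ d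
    = (\<Sum>j\<le>d. fps_const (of_nat (d choose j) * c ^ (d - j) * e ^ j) * fps_X ^ j)"
    by (subst add.commute, subst binomial_ring)
       (auto simp: power_mult_distrib mult_ac fps_of_nat[symmetric] simp flip: fps_const_mult intro!: sum.cong)
  then have "fps_nth ((fps_const c + fps_const e * fps_X) ^ d) i
    = (\<Sum>j\<le>d. if i = j then of_nat (d choose j) * c ^ (d - j) * e ^ j else 0)"
    by (simp add: fps_sum_nth mult_delta_right)
  also have "\<dots> = of_nat (d choose i) * c ^ (d - i) * e ^ i"
    by (simp add: binomial_eq_0)
  finally show ?thesis .
qed

lemma fps_one_plus_X_power_nth:
  "fps_nth ((1 + fps_X) ^ N :: 'a::comm_ring_1 fps) i = of_nat (N choose i)"
  using fps_binomial_nth[of 1 "1::'a" N i] by simp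

text \<open>Two cases of Lucas' theorem. With \<open>P = p ^ e\<close>,
  \<open>(1 + X)^(N + P M) = (1 + X)^N (1 + X^P)^M\<close>, and modulo \<open>X^(2P)\<close> the
  last factor is \<open>1 + M X^P\<close>. Comparing coefficients at \<open>X^j\<close> and at
  \<open>X^P\<close> gives both claims.\<close>

lemma
  assumes "prime p" "of_nat p = (0::'a::comm_ring_1)"
  shows of_nat_choose_add_prime_power_mult:
      "j < p ^ e \<Longrightarrow> of_nat ((N + p ^ e * M) choose j) = (of_nat (N choose j) :: 'a)"
    and of_nat_choose_prime_power:
      "N < p ^ e \<Longrightarrow> of_nat ((N + p ^ e * M) choose (p ^ e)) = (of_nat M :: 'a)"
proof -
  let ?P = "p ^ e"
  have P: "?P > 0" using assms(1) prime_gt_0_nat by simp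
  have p0: "of_nat p = (0 :: 'a fps)" using assms(2) by (simp flip: fps_of_nat)
  have "(1 + fps_X :: 'a fps) ^ (N + ?P * M) = (1 + fps_X) ^ N * (1 + fps_X ^ ?P) ^ M"
    by (simp add: power_add power_mult freshman_dream[OF assms(1) p0])
  also have "(1 + fps_X ^ ?P :: 'a fps) ^ M = 
      1 + of_nat M * fps_X ^ ?P + fps_X ^ (2 * ?P) * (\<Sum>i\<in>{2..M}. of_nat (M choose i) * fps_X ^ (?P * (i - 2)))"
  proof (cases "M = 0")
    case False
    have "(1 + fps_X ^ ?P :: 'a fps) ^ M = (\<Sum>i\<le>M. of_nat (M choose i) * fps_X ^ (?P * i))"
      by (subst add.commute, subst binomial_ring) (simp add: power_mult)
    also have "{..M} = insert 0 (insert 1 {2..M})" using False by auto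
    also have "(\<Sum>i\<in>insert 0 (insert 1 {2..M}). of_nat (M choose i) * fps_X ^ (?P * i) :: 'a fps)
      = 1 + of_nat M * fps_X ^ ?P + (\<Sum>i\<in>{2..M}. of_nat (M choose i) * fps_X ^ (?P * i))"
      by (simp add: add.assoc)
    also have "(\<Sum>i\<in>{2..M}. of_nat (M choose i) * fps_X ^ (?P * i) :: 'a fps)
       = fps_X ^ (2 * ?P) * (\<Sum>i\<in>{2..M}. of_nat (M choose i) * fps_X ^ (?P * (i - 2)))"
      unfolding sum_distrib_left
    proof (rule sum.cong)
      fix i assume "i \<in> {2..M}"
      then have "?P * i = 2 * ?P + ?P * (i - 2)" by (simp add: algebra_simps flip: add_mult_distrib2)
      then show "of_nat (M choose i) * fps_X ^ (?P * i)
         = (fps_X ^ (2 * ?P) * (of_nat (M choose i) * fps_X ^ (?P * (i - 2))) :: 'a fps)"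
        by (simp add: power_add mult_ac)
    qed simp
    finally show ?thesis .
  qed simp
  finally have *: "\<exists>R. (1 + fps_X :: 'a fps) ^ (N + ?P * M)
      = (1 + fps_X) ^ N + fps_const (of_nat M) * (1 + fps_X) ^ N * fps_X ^ ?P + R * fps_X ^ (2 * ?P)"
    by (intro exI[of _ "(1 + fps_X) ^ N * (\<Sum>i\<in>{2..M}. of_nat (M choose i) * fps_X ^ (?P * (i - 2)))"])
       (simp add: algebra_simps fps_of_nat)
  then obtain R where R: "(1 + fps_X :: 'a fps) ^ (N + ?P * M)
      = (1 + fps_X) ^ N + fps_const (of_nat M) * (1 + fps_X) ^ N * fps_X ^ ?P + R * fps_X ^ (2 * ?P)"
    by blast
  show "of_nat ((N + ?P * M) choose j) = (of_nat (N choose j) :: 'a)" if "j < ?P"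
    using arg_cong[OF R, of "\<lambda>f. fps_nth f j"] that
    by (simp add: fps_one_plus_X_power_nth fps_X_power_mult_right_nth)
  show "of_nat ((N + ?P * M) choose ?P) = (of_nat M :: 'a)" if "N < ?P"
    using arg_cong[OF R, of "\<lambda>f. fps_nth f ?P"] that P
    by (simp add: fps_one_plus_X_power_nth fps_X_power_mult_right_nth binomial_eq_0)
qed

lemma finite_field_power_minus_one:
  fixes x :: "'a::{field, finite}"
  assumes "x \<noteq> 0"
  shows "x ^ (CARD('a) - 1) = 1"
proof -
  have "(\<Prod>y\<in>-{0}. x * y) = (\<Prod>y\<in>-{0}. y)"
    using assms by (intro prod.reindex_bij_witness[of _ "\<lambda>y. y / x" "\<lambda>y. x * y"]) auto
  moreover have "(\<Prod>y\<in>-{0}. x * y) = x ^ (CARD('a) - 1) * (\<Prod>y\<in>-{0}. y)"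
    by (simp add: prod.distrib Compl_eq_Diff_UNIV card_Diff_subset)
  moreover have "(\<Prod>y\<in>-{0::'a}. y) \<noteq> 0" by simp
  ultimately show ?thesis by (metis mult_cancel_right1)
qed

text \<open>Some \<open>c \<noteq> 0\<close> has \<open>c ^ N \<noteq> 1\<close>, because
  \<open>X^N - 1\<close> has at most \<open>N\<close> roots. Scaling by \<open>c\<close> permutes
  the nonzero elements and multiplies the sum by \<open>c ^ N\<close>.\<close>

lemma sum_nonzero_power:
  assumes "0 < N" "N < CARD('a::{field, finite}) - 1"
  shows "(\<Sum>x\<in>-{0::'a}. x ^ N) = 0"
proof -
  have "\<exists>c::'a. c \<noteq> 0 \<and> c ^ N \<noteq> 1"
  proof (rule ccontr)
    assume "\<not> ?thesis"
    then have sub: "-{0::'a} \<subseteq> {x. poly (monom 1 N - 1) x = 0}" by (auto simp: poly_monom)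
    have "coeff (monom 1 N - 1 :: 'a poly) N = 1" using assms by (simp add: coeff_eq_0)
    then have nz: "monom 1 N - 1 \<noteq> (0 :: 'a poly)" by (metis coeff_0 zero_neq_one)
    have "CARD('a) - 1 \<le> card {x::'a. poly (monom 1 N - 1) x = 0}"
      using card_mono[OF _ sub] by (simp add: Compl_eq_Diff_UNIV card_Diff_subset)
    also have "\<dots> \<le> degree (monom 1 N - 1 :: 'a poly)" by (rule card_poly_roots_bound[OF nz])
    also have "\<dots> \<le> N" by (simp add: degree_diff_le degree_monom_le)
    finally show False using assms by simp
  qed
  then obtain c :: 'a where c: "c \<noteq> 0" "c ^ N \<noteq> 1" by blast
  have "(\<Sum>x\<in>-{0::'a}. x ^ N) = (\<Sum>x\<in>-{0::'a}. (c * x) ^ N)"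
    using c by (intro sum.reindex_bij_witness[of _ "\<lambda>y. c * y" "\<lambda>y. y / c"]) auto
  also have "\<dots> = c ^ N * (\<Sum>x\<in>-{0::'a}. x ^ N)"
    by (simp add: power_mult_distrib sum_distrib_left)
  finally show ?thesis using c by (metis mult_cancel_right1)
qed

text \<open>Translation by 1 permutes the ring, so it keeps the sum of all elements, yet it adds
  \<open>CARD('a)\<close> ones.\<close>

lemma of_nat_CARD_eq_0: "of_nat CARD('a) = (0 :: 'a::{ring_1, finite})"
proof -
  have "(\<Sum>x\<in>(UNIV::'a set). x + 1) = (\<Sum>x\<in>UNIV. x)"
    by (intro sum.reindex_bij_witness[of _ "\<lambda>x. x - 1" "\<lambda>x. x + 1"]) auto
  then show ?thesis by (simp add: sum.distrib)
qed

text \<open>A recursion that involves \<open>N\<close> only through its image in the ring: knowing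
  that image determines the binomial coefficients up to factorials.\<close>

lemma of_nat_choose_Suc:
  "of_nat (Suc j) * of_nat (N choose Suc j) = (of_nat (N choose j) * (of_nat N - of_nat j) :: 'a::comm_ring_1)"
proof (cases "j \<le> N")
  case True
  have "Suc j * (N choose Suc j) = (N choose j) * (N - j)"
    by (metis binomial_absorb_comp binomial_absorption mult.commute)
  then show ?thesis using True by (metis of_nat_diff of_nat_mult)
qed (simp add: binomial_eq_0)

subsection \<open>Power sums of the binomial\<close>

text \<open>
  With $m = (q+1)/2$, $w = (-a)^m$, $d = 2n - 1$ and $N = n(r-2) - 1$ this is, up to a nonzero factor,
  $\sum_x f(x)^{2n(q-1)}$. It is the coefficient of $X^d$ in
  $(1 - w^2(1 + X))^d (1 + X)^N (1 + w(1 + X)^m)$.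
\<close>
definition hermite_sum :: "'a::comm_ring_1 \<Rightarrow> nat \<Rightarrow> nat \<Rightarrow> nat \<Rightarrow> 'a" where
  "hermite_sum w m d N = (\<Sum>j\<le>d. of_nat (d choose j) * (1 - w\<^sup>2) ^ j * (- w\<^sup>2) ^ (d - j)
    * (of_nat (N choose j) + w * of_nat ((N + m) choose j)))"

text \<open>The geometric series of \<open>1/(b - z X)\<close>. For \<open>b = y - z\<close> it
  expands \<open>1/(y - z (1 + X))\<close>.\<close>

lemma fps_linear_inverse:
  fixes b z :: "'a::field"
  assumes "b \<noteq> 0"
  shows "(fps_const b - fps_const z * fps_X) * Abs_fps (\<lambda>i. z ^ i / b ^ Suc i) = 1"
proof (rule fps_ext)
  fix i
  show "fps_nth ((fps_const b - fps_const z * fps_X) * Abs_fps (\<lambda>i. z ^ i / b ^ Suc i)) i = fps_nth 1 i"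
    using assms by (cases i) (simp_all add: left_diff_distrib mult.assoc)
qed

text \<open>The Cauchy product is the binomial expansion of \<open>(c / b + v) ^ Suc d\<close>
  without its last term. A high power of a fraction thus becomes a coefficient that is linear in the
  geometric series, which makes it summable over the field.\<close>

lemma fps_nth_linear_power_times_inverse:
  fixes b c v z :: "'a::field"
  assumes "b \<noteq> 0"
  shows "fps_nth ((fps_const c + fps_const (v * z) * fps_X) ^ Suc d * Abs_fps (\<lambda>i. z ^ i / b ^ Suc i)) d
    = z ^ d * ((c / b + v) ^ Suc d - v ^ Suc d)"
proof -
  have "fps_nth ((fps_const c + fps_const (v * z) * fps_X) ^ Suc d * Abs_fps (\<lambda>i. z ^ i / b ^ Suc i)) d
    = (\<Sum>i\<le>d. of_nat (Suc d choose i) * c ^ (Suc d - i) * (v * z) ^ i * (z ^ (d - i) / b ^ Suc (d - i)))"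
    by (simp only: fps_mult_nth fps_binomial_nth atMost_atLeast0) simp
  also have "\<dots> = (\<Sum>i\<le>d. z ^ d * (of_nat (Suc d choose i) * v ^ i * (c / b) ^ (Suc d - i)))"
  proof (rule sum.cong)
    fix i assume "i \<in> {..d}"
    then have d: "z ^ d = z ^ i * z ^ (d - i)" "Suc d - i = Suc (d - i)" by (simp_all flip: power_add add: Suc_diff_le)
    show "of_nat (Suc d choose i) * c ^ (Suc d - i) * (v * z) ^ i * (z ^ (d - i) / b ^ Suc (d - i))
      = z ^ d * (of_nat (Suc d choose i) * v ^ i * (c / b) ^ (Suc d - i))"
      unfolding d by (simp add: power_mult_distrib power_divide)
  qed simp
  also have "\<dots> = z ^ d * ((\<Sum>i\<le>Suc d. of_nat (Suc d choose i) * v ^ i * (c / b) ^ (Suc d - i)) - v ^ Suc d)"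
    by (simp add: sum_distrib_left)
  also have "(\<Sum>i\<le>Suc d. of_nat (Suc d choose i) * v ^ i * (c / b) ^ (Suc d - i)) = (c / b + v) ^ Suc d"
    by (subst add.commute, subst binomial_ring) simp
  finally show ?thesis .
qed

text \<open>The power sum of \<open>f\<close> is a coefficient built from the series
  \<open>M\<close>, the sum of \<open>Y^T / (Y - z (1 + X))\<close> over the nonzero elements. The
  relation \<open>Y^m = 1\<close> evaluates \<open>M\<close> in closed form, and computing the same
  coefficient from that form gives \<open>hermite_sum\<close>.\<close>

lemma hermite_sum_eq_0:
  fixes a :: "'a::{field, finite}"
  assumes p: "prime p" "odd p" "q = p ^ k" and card: "CARD('a) = q ^ 2"
    and r: "r > 3" and a: "a \<noteq> 0" "a ^ (q + 1) \<noteq> 1"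
    and bij: "bij (poly (monom 1 r * ([:a:] + monom 1 (2 * (q - 1)))))"
    and n: "n > 0" "2 * (n * (r - 2)) \<le> q"
    and m: "m = (q + 1) div 2" and w: "w = (- a) ^ m"
    and d: "d = 2 * n - 1" and N: "N = n * (r - 2) - 1"
  shows "hermite_sum w m d N = 0"
proof -
  define z where "z = - a"
  define b where "b = a ^ q"
  define T where "T = n * (r - 2)"
  define Y :: "'a \<Rightarrow> 'a" where "Y x = x ^ (2 * (q - 1))" for x
  have "odd q" using p by simp
  then have m2: "2 * m = q + 1" unfolding m by simp
  have nT: "n \<le> T" using r mult_le_mono2[of 1 "r - 2" n] unfolding T_def by linarith
  have q1: "q > 1" using n nT unfolding T_def by linarith
  have T: "0 < T" "T < m" using n m2 nT unfolding T_def by auto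
  have NT: "N = T - 1" unfolding N T_def ..
  have Sd: "Suc d = 2 * n" using n d by simp
  have dq: "d < q" using nT n d unfolding T_def by linarith
  have p0: "of_nat p = (0::'a)"
    using of_nat_CARD_eq_0[where 'a = 'a] card p(3) by simp
  have p0f: "of_nat p = (0::'a fps)" using p0 by (simp flip: fps_of_nat)
  have w2: "w\<^sup>2 = a ^ (q + 1)"
    unfolding w by (simp flip: power_mult add: mult.commute[of m] m2) (simp add: \<open>odd q\<close>)
  have w1: "w \<noteq> 1" using w2 a by auto
  have bz: "b * z = - w\<^sup>2" unfolding w2 b_def z_def by simp
  have wz: "w = z ^ m" unfolding w z_def ..
  have z0: "z \<noteq> 0" unfolding z_def using a by simp
  have qm: "2 * (q - 1) * m = CARD('a) - 1"
  proof -
    have "2 * (q - 1) * m = (q - 1) * (2 * m)" by simp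
    also have "\<dots> = q ^ 2 - 1" unfolding m2 by (cases q) (simp_all add: power2_eq_square)
    finally show ?thesis unfolding card .
  qed
  have Ym: "Y x ^ m = 1" if "x \<noteq> 0" for x
    unfolding Y_def using finite_field_power_minus_one[OF that] by (simp only: qm flip: power_mult)
  \<comment> \<open>\<open>Y x\<close> is an \<open>m\<close>-th root of unity, whereas
    \<open>z ^ m = w\<close> differs from 1.\<close>
  have Yz: "Y x - z \<noteq> 0" if "x \<noteq> 0" for x
    using Ym[OF that] w1 wz by auto
  have Yq: "Y x ^ q * Y x = 1" if "x \<noteq> 0" for x
  proof -
    have "Y x ^ q * Y x = Y x ^ (2 * m)" unfolding m2 by simp
    also have "\<dots> = 1" by (simp only: mult.commute[of 2] power_mult Ym[OF that] power_one)
    finally show ?thesis .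
  qed

  \<comment> \<open>Strictly between 0 and \<open>2 * m\<close> the only multiple of
    \<open>m\<close> is \<open>m\<close> itself. There all terms are 1, and their number
    \<open>q^2 - 1\<close> is -1 in the field.\<close>
  have sumY: "(\<Sum>x\<in>-{0}. Y x ^ e) = (if e = m then -1 else 0)" if e: "0 < e" "e < 2 * m" for e
  proof -
    have small: "(\<Sum>x\<in>-{0}. Y x ^ e) = 0" if e: "0 < e" "e < m" for e
    proof -
      have "2 * (q - 1) * e < CARD('a) - 1" unfolding qm[symmetric] using q1 e by simp
      then have "(\<Sum>x\<in>-{0}. x ^ (2 * (q - 1) * e)) = (0::'a)"
        using q1 e by (intro sum_nonzero_power) auto
      then show ?thesis unfolding Y_def by (simp only: flip: power_mult)
    qed
    consider "e < m" | "e = m" | "m < e" by linarith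
    then show ?thesis
    proof cases
      case 1 then show ?thesis using small e by simp
    next
      case 2
      have "(\<Sum>x\<in>-{0}. Y x ^ e) = (\<Sum>x\<in>-{0::'a}. 1)"
        using 2 Ym by (intro sum.cong) auto
      also have "\<dots> = of_nat (CARD('a) - 1)"
        by (simp add: Compl_eq_Diff_UNIV card_Diff_subset)
      also have "\<dots> = -1"
        using of_nat_CARD_eq_0[where 'a = 'a] by (subst of_nat_diff) (auto simp: Suc_le_eq)
      finally show ?thesis using 2 by simp
    next
      case 3
      have "(\<Sum>x\<in>-{0}. Y x ^ e) = (\<Sum>x\<in>-{0}. Y x ^ (e - m))"
      proof (rule sum.cong)
        fix x :: 'a assume "x \<in> -{0}"
        then have "Y x ^ (m + (e - m)) = Y x ^ (e - m)" using Ym[of x] by (simp only: power_add) simp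
        then show "Y x ^ e = Y x ^ (e - m)" using 3 by simp
      qed simp
      also have "\<dots> = 0" using 3 e by (intro small) auto
      finally show ?thesis using 3 by simp
    qed
  qed

  \<comment> \<open>From \<open>(a + y)^q = a^q + y^q\<close> and \<open>y^q = 1/y\<close> one gets
    \<open>y (a + y)^(q-1) = (b y + 1)/(y + a)\<close>, written here in partial fractions with
    \<open>a b = w^2\<close>. The power of \<open>x\<close> contributes \<open>y^(n r)\<close>, of
    which \<open>y^(2n)\<close> is absorbed and \<open>y^T\<close> remains.\<close>
  have f_power: "poly (monom 1 r * ([:a:] + monom 1 (2 * (q - 1)))) x ^ (2 * n * (q - 1))
     = Y x ^ T * ((1 - w\<^sup>2) / (Y x - z) + b) ^ (2 * n)" if x: "x \<noteq> 0" for x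
  proof -
    let ?y = "Y x"
    have ay: "a + ?y \<noteq> 0" using Yz[OF x] by (simp add: z_def add.commute)
    have e1: "(a + ?y) ^ (q - 1) = (b + ?y ^ q) / (a + ?y)"
    proof -
      have "(a + ?y) ^ (q - 1) * (a + ?y) = (a + ?y) ^ q"
        using q1 by (metis Suc_diff_1 less_trans power_Suc2 zero_less_one)
      also have "\<dots> = b + ?y ^ q" unfolding b_def p(3) by (rule freshman_dream[OF p(1) p0])
      finally show ?thesis using Yz[OF x] by (simp add: field_simps z_def)
    qed
    have "?y * (b + ?y ^ q) = ((1 - w\<^sup>2) / (?y - z) + b) * (a + ?y)"
    proof -
      have "((1 - w\<^sup>2) / (?y - z) + b) * (a + ?y) = 1 - w\<^sup>2 + b * (?y - z)"
        using Yz[OF x] by (simp add: field_simps z_def)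
      also have "\<dots> = 1 + b * ?y" using bz by (simp add: algebra_simps)
      finally show ?thesis using Yq[OF x] by (simp add: algebra_simps)
    qed
    then have e2: "?y * (a + ?y) ^ (q - 1) = (1 - w\<^sup>2) / (?y - z) + b"
      unfolding e1 using ay by simp
    have "poly (monom 1 r * ([:a:] + monom 1 (2 * (q - 1)))) x = x ^ r * (a + ?y)"
      unfolding Y_def by (simp add: poly_monom)
    then have "poly (monom 1 r * ([:a:] + monom 1 (2 * (q - 1)))) x ^ (2 * n * (q - 1))
       = (x ^ r) ^ (2 * n * (q - 1)) * (a + ?y) ^ (2 * n * (q - 1))"
      by (simp add: power_mult_distrib)
    also have "(x ^ r) ^ (2 * n * (q - 1)) = ?y ^ (n * r)"
      unfolding Y_def by (simp flip: power_mult add: mult_ac)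
    also have "n * r = T + 2 * n" unfolding T_def using r by (simp add: diff_mult_distrib2)
    also have "(a + ?y) ^ (2 * n * (q - 1)) = ((a + ?y) ^ (q - 1)) ^ (2 * n)"
      by (simp flip: power_mult add: mult_ac)
    finally show ?thesis by (simp add: power_add power_mult_distrib flip: e2)
  qed

  let ?f = "poly (monom 1 r * ([:a:] + monom 1 (2 * (q - 1))))"
  have "?f ` (-{0}) = -{0}"
  proof -
    have "?f 0 = 0" using r by (simp add: poly_monom)
    then show ?thesis using bij by (metis bij_image_Compl_eq image_empty image_insert)
  qed
  then have bij': "bij_betw ?f (-{0}) (-{0})"
    using bij by (metis bij_betw_subset subset_UNIV bij_def bij_betw_def inj_on_subset)
  have "(\<Sum>x\<in>-{0}. ?f x ^ (2 * n * (q - 1))) = (\<Sum>x\<in>-{0}. x ^ (2 * n * (q - 1)))"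
    using sum.reindex_bij_betw[OF bij', of "\<lambda>y. y ^ (2 * n * (q - 1))"] .
  also have "\<dots> = 0"
  proof (rule sum_nonzero_power)
    have "n < m" using nT T by simp
    then show "2 * n * (q - 1) < CARD('a) - 1" unfolding qm[symmetric] using q1 by simp
  qed (use n q1 in simp)
  finally have zero: "(\<Sum>x\<in>-{0}. Y x ^ T * ((1 - w\<^sup>2) / (Y x - z) + b) ^ (2 * n)) = 0"
    using f_power by simp

  \<comment> \<open>\<open>L x\<close> is \<open>1/(Y x - Z)\<close>. The series \<open>B\<close> is
    \<open>1 - w^2 (1 + X)\<close>; since \<open>b z = -w^2\<close>, it also has the form
    \<open>c + v z X\<close> of the coefficient lemma, with \<open>c = 1 - w^2\<close> and
    \<open>v = b\<close>.\<close>
  define L where "L x = Abs_fps (\<lambda>i. z ^ i / (Y x - z) ^ Suc i)" for x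
  define Z where "Z = fps_const z * (1 + fps_X)"
  define M where "M = (\<Sum>x\<in>-{0}. fps_const (Y x ^ T) * L x)"
  define V :: "'a fps" where "V = (1 + fps_X) ^ m"
  define B where "B = fps_const (1 - w\<^sup>2) + fps_const (- w\<^sup>2) * fps_X"
  have UL: "(fps_const (Y x) - Z) * L x = 1" if "x \<noteq> 0" for x
    using fps_linear_inverse[OF Yz[OF that], of z] unfolding L_def Z_def
    by (simp add: algebra_simps flip: fps_const_sub)
  have const_sum: "(\<Sum>x\<in>-{0}. fps_const (g x)) = fps_const (\<Sum>x\<in>-{0}. g x)" for g :: "'a \<Rightarrow> 'a"
    by (rule fps_ext) (simp add: fps_sum_nth)
  \<comment> \<open>Replacing 1 by \<open>(Y x)^m\<close> makes \<open>1 - Z^m\<close> divisible by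
    \<open>Y x - Z\<close>, which cancels the denominators in \<open>M\<close>.\<close>
  have "(1 - Z ^ m) * M = (\<Sum>x\<in>-{0}. \<Sum>i<m. fps_const (Y x ^ (T + (m - Suc i))) * Z ^ i)"
    unfolding M_def sum_distrib_left
  proof (rule sum.cong)
    fix x :: 'a assume "x \<in> -{0}"
    then have x: "x \<noteq> 0" by simp
    have "1 - Z ^ m = fps_const (Y x) ^ m - Z ^ m" using Ym[OF x] by simp
    also have "\<dots> = - (Z ^ m - fps_const (Y x) ^ m)" by simp
    also have "\<dots> = (fps_const (Y x) - Z) * (\<Sum>i<m. fps_const (Y x) ^ (m - Suc i) * Z ^ i)"
      unfolding power_diff_sumr2 by (simp add: algebra_simps)
    finally have "(1 - Z ^ m) * (fps_const (Y x ^ T) * L x)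
      = ((fps_const (Y x) - Z) * L x) * (fps_const (Y x ^ T) * (\<Sum>i<m. fps_const (Y x) ^ (m - Suc i) * Z ^ i))"
      by (simp only: mult_ac)
    then show "(1 - Z ^ m) * (fps_const (Y x ^ T) * L x) = (\<Sum>i<m. fps_const (Y x ^ (T + (m - Suc i))) * Z ^ i)"
      by (simp only: UL[OF x] mult_1 sum_distrib_left power_add fps_const_power mult.assoc flip: fps_const_mult)
  qed simp
  also have "\<dots> = (\<Sum>i<m. fps_const (\<Sum>x\<in>-{0}. Y x ^ (T + (m - Suc i))) * Z ^ i)"
    by (subst sum.swap) (simp only: sum_distrib_right flip: const_sum)
  \<comment> \<open>The exponent \<open>T + (m - 1 - i)\<close> lies strictly between 0 and
    \<open>2 * m\<close>, and it equals \<open>m\<close> only for \<open>i = T - 1\<close>.\<close>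
  also have "\<dots> = (\<Sum>i<m. if i = T - 1 then - (Z ^ i) else 0)"
  proof (rule sum.cong)
    fix i assume "i \<in> {..<m}"
    then have "0 < T + (m - Suc i)" "T + (m - Suc i) < 2 * m" "T + (m - Suc i) = m \<longleftrightarrow> i = T - 1"
      using T by auto
    then show "fps_const (\<Sum>x\<in>-{0}. Y x ^ (T + (m - Suc i))) * Z ^ i = (if i = T - 1 then - (Z ^ i) else 0)"
      by (auto simp: sumY simp flip: fps_const_neg)
  qed simp
  also have "\<dots> = - (Z ^ N)" using T NT by simp
  finally have "(1 - fps_const w * V) * M = - (Z ^ N)"
    unfolding Z_def V_def wz by (simp add: power_mult_distrib)
  \<comment> \<open>The conjugate factor turns \<open>V\<close> into
    \<open>V^2 = (1 + X)(1 + X^q)\<close>, so that the factor of \<open>M\<close> agrees with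
    \<open>B\<close> modulo \<open>X^q\<close>.\<close>
  then have "(1 + fps_const w * V) * (1 - fps_const w * V) * M = - ((1 + fps_const w * V) * Z ^ N)"
    by (simp only: mult.assoc mult_minus_right)
  moreover have "(1 + fps_const w * V) * (1 - fps_const w * V) = B - fps_const (w\<^sup>2) * (1 + fps_X) * fps_X ^ q"
  proof -
    have sq: "(1 + u * v) * (1 - u * v) = 1 - u\<^sup>2 * v\<^sup>2" for u v :: "'a fps"
      by (simp add: algebra_simps power2_eq_square)
    have B: "B = 1 - fps_const (w\<^sup>2) * (1 + fps_X)"
      unfolding B_def by (simp add: distrib_left flip: fps_const_sub fps_const_neg)
    have "V\<^sup>2 = (1 + fps_X) ^ (q + 1)"
      unfolding V_def by (simp only: mult.commute[of m 2] m2 flip: power_mult)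
    also have "\<dots> = (1 + fps_X) ^ q * (1 + fps_X)" by (simp only: power_add power_one_right)
    also have "(1 + fps_X :: 'a fps) ^ q = 1 + fps_X ^ q"
      unfolding p(3) using freshman_dream[OF p(1) p0f, of 1 fps_X] by simp
    finally show ?thesis unfolding sq fps_const_power B by (simp only: ring_distribs mult_ac) simp
  qed
  ultimately have "(B - fps_const (w\<^sup>2) * (1 + fps_X) * fps_X ^ q) * M = - ((1 + fps_const w * V) * Z ^ N)"
    by simp
  then have BM: "B * M = fps_const (w\<^sup>2) * (1 + fps_X) * M * fps_X ^ q - (1 + fps_const w * V) * Z ^ N"
    by (simp add: algebra_simps)

  \<comment> \<open>First computation of the coefficient, through the fractions: a multiple of the
    vanishing power sum, minus a multiple of the sum of \<open>Y^T\<close>, which is 0 because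
    \<open>0 < T < m\<close>.\<close>
  have "fps_nth (B ^ Suc d * M) d = (\<Sum>x\<in>-{0}. Y x ^ T * fps_nth (B ^ Suc d * L x) d)"
    unfolding M_def sum_distrib_left fps_sum_nth
    by (intro sum.cong) (simp_all only: mult.left_commute[of "B ^ Suc d"] fps_mult_left_const_nth)
  also have "\<dots> = (\<Sum>x\<in>-{0}. Y x ^ T * (z ^ d * (((1 - w\<^sup>2) / (Y x - z) + b) ^ Suc d - b ^ Suc d)))"
  proof (rule sum.cong)
    fix x :: 'a assume "x \<in> -{0}"
    then have x: "x \<noteq> 0" by simp
    show "Y x ^ T * fps_nth (B ^ Suc d * L x) d
      = Y x ^ T * (z ^ d * (((1 - w\<^sup>2) / (Y x - z) + b) ^ Suc d - b ^ Suc d))"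
      unfolding B_def L_def bz[symmetric] fps_nth_linear_power_times_inverse[OF Yz[OF x]] ..
  qed simp
  also have "\<dots> = z ^ d * ((\<Sum>x\<in>-{0}. Y x ^ T * ((1 - w\<^sup>2) / (Y x - z) + b) ^ Suc d) - b ^ Suc d * (\<Sum>x\<in>-{0}. Y x ^ T))"
    by (simp add: sum_distrib_left sum_subtractf algebra_simps del: power_Suc)
  also have "\<dots> = 0" using zero sumY[of T] T unfolding Sd by simp
  finally have "fps_nth (B ^ Suc d * M) d = 0" .
  \<comment> \<open>Second computation, through \<open>BM\<close>: the multiple of
    \<open>X^q\<close> does not reach \<open>X^d\<close> because \<open>d < q\<close>, and the
    nonzero factor \<open>z ^ N\<close> cancels.\<close>
  moreover have "B ^ Suc d * M = (B ^ d * fps_const (w\<^sup>2) * (1 + fps_X) * M) * fps_X ^ q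
      - fps_const (z ^ N) * (B ^ d * ((1 + fps_X) ^ N + fps_const w * (1 + fps_X) ^ (N + m)))"
  proof -
    have "B ^ Suc d * M = B ^ d * (B * M)" by (simp add: mult_ac)
    also have "\<dots> = (B ^ d * fps_const (w\<^sup>2) * (1 + fps_X) * M) * fps_X ^ q - B ^ d * ((1 + fps_const w * V) * Z ^ N)"
      unfolding BM by (simp only: right_diff_distrib mult.assoc)
    also have "Z ^ N = fps_const (z ^ N) * (1 + fps_X) ^ N"
      unfolding Z_def by (simp only: power_mult_distrib fps_const_power)
    also have "B ^ d * ((1 + fps_const w * V) * (fps_const (z ^ N) * (1 + fps_X) ^ N))
      = fps_const (z ^ N) * (B ^ d * ((1 + fps_X) ^ N + fps_const w * (1 + fps_X) ^ (N + m)))"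
      unfolding V_def power_add by (simp only: ring_distribs mult_ac mult_1_left mult_1_right)
    finally show ?thesis .
  qed
  ultimately have "fps_nth (B ^ d * ((1 + fps_X) ^ N + fps_const w * (1 + fps_X) ^ (N + m))) d = 0"
    using dq z0 by (simp add: fps_X_power_mult_right_nth)
  also have "B ^ d * ((1 + fps_X) ^ N + fps_const w * (1 + fps_X) ^ (N + m))
     = ((1 + fps_X) ^ N + fps_const w * (1 + fps_X) ^ (N + m)) * B ^ d" by (rule mult.commute)
  finally show ?thesis
    unfolding hermite_sum_def B_def fps_mult_nth fps_binomial_nth atMost_atLeast0
    by (simp add: fps_one_plus_X_power_nth fps_one_plus_X_power_nth[unfolded add.commute[of 1]] algebra_simps flip: binomial_symmetric)
qed

subsection \<open>Consequences of vanishing power sums\<close>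

lemma of_nat_choose_small:
  fixes N :: nat
  defines "x \<equiv> (of_nat N :: 'a::comm_ring_1)"
  shows "2 * of_nat (N choose 2) = x * (x - 1)"
    and "6 * of_nat (N choose 3) = x * (x - 1) * (x - 2)"
proof -
  have 2: "2 * of_nat (N choose 2) = x * (x - 1)"
    using of_nat_choose_Suc[of 1 N, where 'a = 'a] by (simp add: x_def numeral_2_eq_2)
  have 3: "3 * of_nat (N choose 3) = of_nat (N choose 2) * (x - 2)"
    using of_nat_choose_Suc[of 2 N, where 'a = 'a] by (simp add: x_def)
  have "6 * of_nat (N choose 3) = 2 * (3 * of_nat (N choose 3) :: 'a)" by simp
  also have "\<dots> = (2 * of_nat (N choose 2)) * (x - 2)" unfolding 3 by (simp add: mult.assoc)
  finally show "6 * of_nat (N choose 3) = x * (x - 1) * (x - 2)" unfolding 2 .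
qed (use of_nat_choose_Suc[of 1 N, where 'a = 'a] in \<open>simp add: x_def numeral_2_eq_2\<close>)

text \<open>The case \<open>n = 1\<close>, used with \<open>N = r - 3\<close>. As \<open>m\<close>
  is 1/2 in the field, twice the sum is \<open>1 + w\<close> times the difference of the two
  sides.\<close>

lemma hermite_sum_1_eq_0:
  fixes w :: "'a::field"
  assumes m: "2 * of_nat m = (1::'a)" and w: "w\<^sup>2 \<noteq> 1" and H: "hermite_sum w m 1 N = 0"
  shows "2 * (1 - w\<^sup>2) * of_nat N = w * (3 * w - 1)"
proof -
  have w1: "1 + w \<noteq> 0"
  proof
    assume "1 + w = 0"
    then have "w = - 1" by (simp add: eq_neg_iff_add_eq_0 add.commute)
    then show False using w by simp
  qed
  have "hermite_sum w m 1 N = - w\<^sup>2 * (1 + w) + (1 - w\<^sup>2) * (of_nat N + w * (of_nat N + of_nat m))"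
    unfolding hermite_sum_def by simp
  then have "(1 + w) * (2 * (1 - w\<^sup>2) * of_nat N - w * (3 * w - 1)) = 0"
    unfolding H using m by algebra
  then show ?thesis using w1 by simp
qed

text \<open>The case \<open>n = 2\<close>, used with \<open>N = 2 (r - 3) + 1\<close>; the
  assumption on \<open>N\<close> is the equation for \<open>n = 1\<close>. Powers of
  \<open>D = 1 - w^2\<close> clear the denominators of the binomials, leaving a polynomial in
  \<open>w\<close> that factors.\<close>

lemma hermite_sum_3_eq_0:
  fixes w :: "'a::field"
  assumes m: "2 * of_nat m = (1::'a)" and w: "w\<^sup>2 \<noteq> 1"
    and N: "(1 - w\<^sup>2) * of_nat N = 1 - w + 2 * w\<^sup>2" and H: "hermite_sum w m 3 N = 0"
  shows "w * (3 * w - 1) * (w\<^sup>2 - 2 * w + 5) * (w\<^sup>2 + 2 * w - 1) = 0"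
proof -
  have w1: "w + 1 \<noteq> 0"
  proof
    assume "w + 1 = 0"
    then have "w = - 1" by (simp add: eq_neg_iff_add_eq_0)
    then show False using w by simp
  qed
  define x y X D c2 e2 c3 e3 where "x = (of_nat N :: 'a)" and "y = (of_nat (N + m) :: 'a)"
    and "X = 1 - w + 2 * w\<^sup>2" and "D = 1 - w\<^sup>2"
    and "c2 = (of_nat (N choose 2) :: 'a)" and "e2 = (of_nat ((N + m) choose 2) :: 'a)"
    and "c3 = (of_nat (N choose 3) :: 'a)" and "e3 = (of_nat ((N + m) choose 3) :: 'a)"
  note defs = x_def y_def c2_def e2_def c3_def e3_def D_def
  have y: "2 * y = 2 * x + 1" using m by (simp add: defs algebra_simps)
  have x: "D * x = X" using N by (simp add: defs X_def)
  have Y: "2 * D * y = 2 * X + D"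
  proof -
    have "2 * D * y = D * (2 * y)" by simp
    also have "\<dots> = 2 * (D * x) + D" unfolding y by algebra
    finally show ?thesis unfolding x .
  qed
  note c = of_nat_choose_small[where 'a = 'a, of N, folded defs]
  note e = of_nat_choose_small[where 'a = 'a, of "N + m", folded defs]
  have C2: "2 * (D\<^sup>2 * c2) = X * (X - D)"
  proof -
    have "2 * (D\<^sup>2 * c2) = D\<^sup>2 * (2 * c2)" by simp
    also have "\<dots> = (D * x) * (D * x - D)" unfolding c(1) by algebra
    finally show ?thesis unfolding x .
  qed
  have C3: "6 * (D ^ 3 * c3) = X * (X - D) * (X - 2 * D)"
  proof -
    have "6 * (D ^ 3 * c3) = D ^ 3 * (6 * c3)" by simp
    also have "\<dots> = (D * x) * (D * x - D) * (D * x - 2 * D)" unfolding c(2) by algebra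
    finally show ?thesis unfolding x .
  qed
  have E2: "8 * (D\<^sup>2 * e2) = (2 * X + D) * (2 * X - D)"
  proof -
    have "8 * (D\<^sup>2 * e2) = 4 * D\<^sup>2 * (2 * e2)" by simp
    also have "\<dots> = (2 * D * y) * (2 * D * y - 2 * D)" unfolding e(1) by algebra
    also have "\<dots> = (2 * X + D) * (2 * X - D)" unfolding Y by algebra
    finally show ?thesis .
  qed
  have E3: "48 * (D ^ 3 * e3) = (2 * X + D) * (2 * X - D) * (2 * X - 3 * D)"
  proof -
    have "48 * (D ^ 3 * e3) = 8 * D ^ 3 * (6 * e3)" by simp
    also have "\<dots> = (2 * D * y) * (2 * D * y - 2 * D) * (2 * D * y - 4 * D)" unfolding e(2) by algebra
    also have "\<dots> = (2 * X + D) * (2 * X - D) * (2 * X - 3 * D)" unfolding Y by algebra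
    finally show ?thesis .
  qed
  have "hermite_sum w m 3 N = (- w\<^sup>2) ^ 3 * (1 + w) + 3 * D * (- w\<^sup>2)\<^sup>2 * (x + w * y)
      + 3 * D\<^sup>2 * (- w\<^sup>2) * (c2 + w * e2) + D ^ 3 * (c3 + w * e3)"
    unfolding hermite_sum_def defs by (simp add: eval_nat_numeral)
  \<comment> \<open>The factor \<open>48 = 2^3 * 3!\<close> clears the halves in
    \<open>y = x + 1/2\<close> and the factorials.\<close>
  then have "0 = 48 * ((- w\<^sup>2) ^ 3 * (1 + w) + 3 * D * (- w\<^sup>2)\<^sup>2 * (x + w * y)
      + 3 * D\<^sup>2 * (- w\<^sup>2) * (c2 + w * e2) + D ^ 3 * (c3 + w * e3))"
    unfolding H by simp
  also have "\<dots> = 48 * (- w\<^sup>2) ^ 3 * (1 + w) + 3 * w ^ 4 * (48 * (D * x) + 24 * w * (2 * D * y))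
      - 3 * w\<^sup>2 * (24 * (2 * (D\<^sup>2 * c2)) + 6 * w * (8 * (D\<^sup>2 * e2)))
      + (8 * (6 * (D ^ 3 * c3)) + w * (48 * (D ^ 3 * e3)))"
    by algebra
  also have "\<dots> = w * (w + 1) * (3 * w - 1) * (w\<^sup>2 - 2 * w + 5) * (w\<^sup>2 + 2 * w - 1)"
    unfolding x Y C2 C3 E2 E3 unfolding X_def D_def by algebra
  finally show ?thesis using w1 by simp
qed

text \<open>
  In the next three lemmas the numbers come from reducing $k^j\, j! \binom{N}{j}$,
  $k^j\, j! \binom{N+m}{j}$ and the powers of $1 - w^2$ and $-w^2$ modulo the quadratic equation
  for $w$, where $k$ is the common denominator of $N$ and $N + 1/2$.
\<close>
lemma hermite_sum_5_eq_0_generic: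
  fixes w :: "'a::field"
  assumes w: "w\<^sup>2 = 1 - 2 * w" and m: "2 * of_nat m = (1::'a)" and N: "4 * of_nat N = 9 * w + 5"
    and nz: "2 \<noteq> (0::'a)" "3 \<noteq> (0::'a)" and H: "hermite_sum w m 5 N = 0"
  shows "29 * w = 12"
proof -
  define c where "c j = (of_nat (N choose j) :: 'a)" for j
  define e where "e j = (of_nat ((N + m) choose j) :: 'a)" for j
  note rc = of_nat_choose_Suc[where 'a = 'a, of _ N, folded c_def]
  note re = of_nat_choose_Suc[where 'a = 'a, of _ "N + m", folded e_def]
  have M: "4 * (of_nat (N + m) :: 'a) = 7 + 9 * w" using N m by (simp; algebra)
  have 0: "c 0 = 1" "e 0 = 1" unfolding c_def e_def by simp_all
  have c1: "4 * c 1 = 5 + 9 * w" using N by (simp add: c_def)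
  have c2: "32 * c 2 = 86 - 108 * w" using rc[of 1] c1 N w by (simp add: numeral_2_eq_2) algebra
  have c3: "384 * c 3 = 3042 * w - 1230" using rc[of 2] c2 N w by simp algebra
  have c4: "6144 * c 4 = 35988 - 87120 * w" using rc[of 3] c3 N w by simp algebra
  have c5: "122880 * c 5 = 2850372 * w - 1179948" using rc[of 4] c4 N w by simp algebra
  have e1: "4 * e 1 = 7 + 9 * w" using M by (simp add: e_def)
  have e2: "32 * e 2 = 102 - 72 * w" using re[of 1] e1 M w by (simp add: numeral_2_eq_2) algebra
  have e3: "384 * e 3 = 2286 * w - 750" using re[of 2] e2 M w by simp algebra
  have e4: "6144 * e 4 = 24324 - 59328 * w" using re[of 3] e3 M w by simp algebra
  have e5: "122880 * e 5 = 1820772 * w - 752868" using re[of 4] e4 M w by simp algebra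
  have t0: "122880 * (c 0 + w * e 0) = 122880 + 122880 * w" by (simp add: 0 algebra_simps)
  have t1: "122880 * (c 1 + w * e 1) = 430080 - 61440 * w"
  proof -
    have "122880 * (c 1 + w * e 1) = 30720 * (4 * c 1) + 30720 * w * (4 * e 1)" by algebra
    also have "\<dots> = 430080 - 61440 * w" unfolding c1 e1 using w by algebra
    finally show ?thesis .
  qed
  have t2: "122880 * (c 2 + w * e 2) = 53760 + 529920 * w"
  proof -
    have "122880 * (c 2 + w * e 2) = 3840 * (32 * c 2) + 3840 * w * (32 * e 2)" by algebra
    also have "\<dots> = 53760 + 529920 * w" unfolding c2 e2 using w by algebra
    finally show ?thesis .
  qed
  have t3: "122880 * (c 3 + w * e 3) = 337920 - 729600 * w"
  proof -
    have "122880 * (c 3 + w * e 3) = 320 * (384 * c 3) + 320 * w * (384 * e 3)" by algebra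
    also have "\<dots> = 337920 - 729600 * w" unfolding c3 e3 using w by algebra
    finally show ?thesis .
  qed
  have t4: "122880 * (c 4 + w * e 4) = 1117200 * w - 466800"
  proof -
    have "122880 * (c 4 + w * e 4) = 20 * (6144 * c 4) + 20 * w * (6144 * e 4)" by algebra
    also have "\<dots> = 1117200 * w - 466800" unfolding c4 e4 using w by algebra
    finally show ?thesis .
  qed
  have t5: "122880 * (c 5 + w * e 5) = 640824 - 1544040 * w"
  proof -
    have "122880 * (c 5 + w * e 5) = 1 * (122880 * c 5) + 1 * w * (122880 * e 5)" by algebra
    also have "\<dots> = 640824 - 1544040 * w" unfolding c5 e5 using w by algebra
    finally show ?thesis .
  qed
  have u: "1 - w\<^sup>2 = 2 * w" "- w\<^sup>2 = 2 * w - 1" unfolding w by simp_all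
  have p0: "(1 - w\<^sup>2) ^ 0 * (- w\<^sup>2) ^ 5 = 2378 * w - 985" unfolding u using w by algebra
  have p1: "(1 - w\<^sup>2) ^ 1 * (- w\<^sup>2) ^ 4 = 1970 * w - 816" unfolding u using w by algebra
  have p2: "(1 - w\<^sup>2) ^ 2 * (- w\<^sup>2) ^ 3 = 1632 * w - 676" unfolding u using w by algebra
  have p3: "(1 - w\<^sup>2) ^ 3 * (- w\<^sup>2) ^ 2 = 1352 * w - 560" unfolding u using w by algebra
  have p4: "(1 - w\<^sup>2) ^ 4 * (- w\<^sup>2) ^ 1 = 1120 * w - 464" unfolding u using w by algebra
  have p5: "(1 - w\<^sup>2) ^ 5 * (- w\<^sup>2) ^ 0 = 928 * w - 384" unfolding u using w by algebra
  have "hermite_sum w m 5 N = 1 * ((1 - w\<^sup>2) ^ 0 * (- w\<^sup>2) ^ 5) * (c 0 + w * e 0) + 5 * ((1 - w\<^sup>2) ^ 1 * (- w\<^sup>2) ^ 4) * (c 1 + w * e 1) + 10 * ((1 - w\<^sup>2) ^ 2 * (- w\<^sup>2) ^ 3) * (c 2 + w * e 2) + 10 * ((1 - w\<^sup>2) ^ 3 * (- w\<^sup>2) ^ 2) * (c 3 + w * e 3) + 5 * ((1 - w\<^sup>2) ^ 4 * (- w\<^sup>2) ^ 1) * (c 4 + w * e 4) + 1 * ((1 - w\<^sup>2) ^ 5 * (- w\<^sup>2) ^ 0) * (c 5 + w * e 5)"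
    unfolding hermite_sum_def c_def e_def by (simp add: eval_nat_numeral mult.assoc)
  note sum = this[unfolded p0 p1 p2 p3 p4 p5]
  \<comment> \<open>Modulo the quadratic everything collapses to a multiple of
    \<open>29 * w - 12\<close>; the numerical factor contains only the primes 2 and 3, which
    \<open>nz\<close> makes invertible.\<close>
  have "2 ^ 9 * 3 ^ 2 * (29 * w - 12) = 1 * (2378 * w - 985) * (122880 + 122880 * w) + 5 * (1970 * w - 816) * (430080 - 61440 * w) + 10 * (1632 * w - 676) * (53760 + 529920 * w) + 10 * (1352 * w - 560) * (337920 - 729600 * w) + 5 * (1120 * w - 464) * (1117200 * w - 466800) + 1 * (928 * w - 384) * (640824 - 1544040 * w)"
    using w by algebra
  also have "\<dots> = 1 * (2378 * w - 985) * (122880 * (c 0 + w * e 0)) + 5 * (1970 * w - 816) * (122880 * (c 1 + w * e 1)) + 10 * (1632 * w - 676) * (122880 * (c 2 + w * e 2)) + 10 * (1352 * w - 560) * (122880 * (c 3 + w * e 3)) + 5 * (1120 * w - 464) * (122880 * (c 4 + w * e 4)) + 1 * (928 * w - 384) * (122880 * (c 5 + w * e 5))"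
    unfolding t0 t1 t2 t3 t4 t5 ..
  also have "\<dots> = 122880 * hermite_sum w m 5 N" unfolding sum by algebra
  also have "\<dots> = 0" unfolding H by simp
  finally have "29 * w - 12 = 0"
    using nz by (simp only: mult_eq_0_iff power_eq_0_iff simp_thms)
  then show ?thesis by algebra
qed

lemma hermite_sum_5_eq_0_exceptional:
  fixes w :: "'a::field"
  assumes w: "w\<^sup>2 = 2 * w - 5" and m: "2 * of_nat m = (1::'a)" and N: "4 * of_nat N = (- 7 :: 'a)"
    and nz: "2 \<noteq> (0::'a)" "3 \<noteq> (0::'a)" "5 \<noteq> (0::'a)" and H: "hermite_sum w m 5 N = 0"
  shows "5 * w = 14"
proof -
  define c where "c j = (of_nat (N choose j) :: 'a)" for j
  define e where "e j = (of_nat ((N + m) choose j) :: 'a)" for j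
  note rc = of_nat_choose_Suc[where 'a = 'a, of _ N, folded c_def]
  note re = of_nat_choose_Suc[where 'a = 'a, of _ "N + m", folded e_def]
  have M: "4 * (of_nat (N + m) :: 'a) = - 5" using N m by (simp; algebra)
  have 0: "c 0 = 1" "e 0 = 1" unfolding c_def e_def by simp_all
  have c1: "4 * c 1 = - 7" using N by (simp add: c_def)
  have c2: "32 * c 2 = 77" using rc[of 1] c1 N w by (simp add: numeral_2_eq_2) algebra
  have c3: "384 * c 3 = - 1155" using rc[of 2] c2 N w by simp algebra
  have c4: "6144 * c 4 = 21945" using rc[of 3] c3 N w by simp algebra
  have c5: "122880 * c 5 = - 504735" using rc[of 4] c4 N w by simp algebra
  have e1: "4 * e 1 = - 5" using M by (simp add: e_def)
  have e2: "32 * e 2 = 45" using re[of 1] e1 M w by (simp add: numeral_2_eq_2) algebra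
  have e3: "384 * e 3 = - 585" using re[of 2] e2 M w by simp algebra
  have e4: "6144 * e 4 = 9945" using re[of 3] e3 M w by simp algebra
  have e5: "122880 * e 5 = - 208845" using re[of 4] e4 M w by simp algebra
  have t0: "122880 * (c 0 + w * e 0) = 122880 + 122880 * w" by (simp add: 0 algebra_simps)
  have t1: "122880 * (c 1 + w * e 1) = - 215040 - 153600 * w"
  proof -
    have "122880 * (c 1 + w * e 1) = 30720 * (4 * c 1) + 30720 * w * (4 * e 1)" by algebra
    also have "\<dots> = - 215040 - 153600 * w" unfolding c1 e1 by simp
    finally show ?thesis .
  qed
  have t2: "122880 * (c 2 + w * e 2) = 295680 + 172800 * w"
  proof -
    have "122880 * (c 2 + w * e 2) = 3840 * (32 * c 2) + 3840 * w * (32 * e 2)" by algebra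
    also have "\<dots> = 295680 + 172800 * w" unfolding c2 e2 by simp
    finally show ?thesis .
  qed
  have t3: "122880 * (c 3 + w * e 3) = - 369600 - 187200 * w"
  proof -
    have "122880 * (c 3 + w * e 3) = 320 * (384 * c 3) + 320 * w * (384 * e 3)" by algebra
    also have "\<dots> = - 369600 - 187200 * w" unfolding c3 e3 by simp
    finally show ?thesis .
  qed
  have t4: "122880 * (c 4 + w * e 4) = 438900 + 198900 * w"
  proof -
    have "122880 * (c 4 + w * e 4) = 20 * (6144 * c 4) + 20 * w * (6144 * e 4)" by algebra
    also have "\<dots> = 438900 + 198900 * w" unfolding c4 e4 by simp
    finally show ?thesis .
  qed
  have t5: "122880 * (c 5 + w * e 5) = - 504735 - 208845 * w"
  proof -
    have "122880 * (c 5 + w * e 5) = 1 * (122880 * c 5) + 1 * w * (122880 * e 5)" by algebra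
    also have "\<dots> = - 504735 - 208845 * w" unfolding c5 e5 by simp
    finally show ?thesis .
  qed
  have u: "1 - w\<^sup>2 = 6 - 2 * w" "- w\<^sup>2 = 5 - 2 * w" unfolding w by simp_all
  have p0: "(1 - w\<^sup>2) ^ 0 * (- w\<^sup>2) ^ 5 = 1558 * w - 1795" unfolding u using w by algebra
  have p1: "(1 - w\<^sup>2) ^ 1 * (- w\<^sup>2) ^ 4 = 1726 * w - 2490" unfolding u using w by algebra
  have p2: "(1 - w\<^sup>2) ^ 2 * (- w\<^sup>2) ^ 3 = 1872 * w - 3280" unfolding u using w by algebra
  have p3: "(1 - w\<^sup>2) ^ 3 * (- w\<^sup>2) ^ 2 = 1984 * w - 4160" unfolding u using w by algebra
  have p4: "(1 - w\<^sup>2) ^ 4 * (- w\<^sup>2) ^ 1 = 2048 * w - 5120" unfolding u using w by algebra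
  have p5: "(1 - w\<^sup>2) ^ 5 * (- w\<^sup>2) ^ 0 = 2048 * w - 6144" unfolding u using w by algebra
  have "hermite_sum w m 5 N = 1 * ((1 - w\<^sup>2) ^ 0 * (- w\<^sup>2) ^ 5) * (c 0 + w * e 0) + 5 * ((1 - w\<^sup>2) ^ 1 * (- w\<^sup>2) ^ 4) * (c 1 + w * e 1) + 10 * ((1 - w\<^sup>2) ^ 2 * (- w\<^sup>2) ^ 3) * (c 2 + w * e 2) + 10 * ((1 - w\<^sup>2) ^ 3 * (- w\<^sup>2) ^ 2) * (c 3 + w * e 3) + 5 * ((1 - w\<^sup>2) ^ 4 * (- w\<^sup>2) ^ 1) * (c 4 + w * e 4) + 1 * ((1 - w\<^sup>2) ^ 5 * (- w\<^sup>2) ^ 0) * (c 5 + w * e 5)"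
    unfolding hermite_sum_def c_def e_def by (simp add: eval_nat_numeral mult.assoc)
  note sum = this[unfolded p0 p1 p2 p3 p4 p5]
  have "2 ^ 15 * 3 ^ 2 * 5 ^ 1 * (14 - 5 * w) = 1 * (1558 * w - 1795) * (122880 + 122880 * w) + 5 * (1726 * w - 2490) * (- 215040 - 153600 * w) + 10 * (1872 * w - 3280) * (295680 + 172800 * w) + 10 * (1984 * w - 4160) * (- 369600 - 187200 * w) + 5 * (2048 * w - 5120) * (438900 + 198900 * w) + 1 * (2048 * w - 6144) * (- 504735 - 208845 * w)"
    using w by algebra
  also have "\<dots> = 1 * (1558 * w - 1795) * (122880 * (c 0 + w * e 0)) + 5 * (1726 * w - 2490) * (122880 * (c 1 + w * e 1)) + 10 * (1872 * w - 3280) * (122880 * (c 2 + w * e 2)) + 10 * (1984 * w - 4160) * (122880 * (c 3 + w * e 3)) + 5 * (2048 * w - 5120) * (122880 * (c 4 + w * e 4)) + 1 * (2048 * w - 6144) * (122880 * (c 5 + w * e 5))"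
    unfolding t0 t1 t2 t3 t4 t5 ..
  also have "\<dots> = 122880 * hermite_sum w m 5 N" unfolding sum by algebra
  also have "\<dots> = 0" unfolding H by simp
  finally have "14 - 5 * w = 0"
    using nz by (simp only: mult_eq_0_iff power_eq_0_iff simp_thms)
  then show ?thesis by algebra
qed

lemma hermite_sum_7_eq_0_exceptional:
  fixes w :: "'a::field"
  assumes w: "w\<^sup>2 = 2 * w - 5" and m: "2 * of_nat m = (1::'a)" and N: "of_nat N = (- 2 :: 'a)"
    and nz: "2 \<noteq> (0::'a)" "3 \<noteq> (0::'a)" "5 \<noteq> (0::'a)" "7 \<noteq> (0::'a)" and H: "hermite_sum w m 7 N = 0"
  shows "41 * w = - 73"
proof -
  define c where "c j = (of_nat (N choose j) :: 'a)" for j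
  define e where "e j = (of_nat ((N + m) choose j) :: 'a)" for j
  note rc = of_nat_choose_Suc[where 'a = 'a, of _ N, folded c_def]
  note re = of_nat_choose_Suc[where 'a = 'a, of _ "N + m", folded e_def]
  have M: "2 * (of_nat (N + m) :: 'a) = - 3" using N m by (simp; algebra)
  have 0: "c 0 = 1" "e 0 = 1" unfolding c_def e_def by simp_all
  have c1: "2 * c 1 = - 4" using N by (simp add: c_def)
  have c2: "8 * c 2 = 24" using rc[of 1] c1 N w by (simp add: numeral_2_eq_2) algebra
  have c3: "48 * c 3 = - 192" using rc[of 2] c2 N w by simp algebra
  have c4: "384 * c 4 = 1920" using rc[of 3] c3 N w by simp algebra
  have c5: "3840 * c 5 = - 23040" using rc[of 4] c4 N w by simp algebra
  have c6: "46080 * c 6 = 322560" using rc[of 5] c5 N w by simp algebra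
  have c7: "645120 * c 7 = - 5160960" using rc[of 6] c6 N w by simp algebra
  have e1: "2 * e 1 = - 3" using M by (simp add: e_def)
  have e2: "8 * e 2 = 15" using re[of 1] e1 M w by (simp add: numeral_2_eq_2) algebra
  have e3: "48 * e 3 = - 105" using re[of 2] e2 M w by simp algebra
  have e4: "384 * e 4 = 945" using re[of 3] e3 M w by simp algebra
  have e5: "3840 * e 5 = - 10395" using re[of 4] e4 M w by simp algebra
  have e6: "46080 * e 6 = 135135" using re[of 5] e5 M w by simp algebra
  have e7: "645120 * e 7 = - 2027025" using re[of 6] e6 M w by simp algebra
  have t0: "645120 * (c 0 + w * e 0) = 645120 + 645120 * w" by (simp add: 0 algebra_simps)
  have t1: "645120 * (c 1 + w * e 1) = - 1290240 - 967680 * w"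
  proof -
    have "645120 * (c 1 + w * e 1) = 322560 * (2 * c 1) + 322560 * w * (2 * e 1)" by algebra
    also have "\<dots> = - 1290240 - 967680 * w" unfolding c1 e1 by simp
    finally show ?thesis .
  qed
  have t2: "645120 * (c 2 + w * e 2) = 1935360 + 1209600 * w"
  proof -
    have "645120 * (c 2 + w * e 2) = 80640 * (8 * c 2) + 80640 * w * (8 * e 2)" by algebra
    also have "\<dots> = 1935360 + 1209600 * w" unfolding c2 e2 by simp
    finally show ?thesis .
  qed
  have t3: "645120 * (c 3 + w * e 3) = - 2580480 - 1411200 * w"
  proof -
    have "645120 * (c 3 + w * e 3) = 13440 * (48 * c 3) + 13440 * w * (48 * e 3)" by algebra
    also have "\<dots> = - 2580480 - 1411200 * w" unfolding c3 e3 by simp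
    finally show ?thesis .
  qed
  have t4: "645120 * (c 4 + w * e 4) = 3225600 + 1587600 * w"
  proof -
    have "645120 * (c 4 + w * e 4) = 1680 * (384 * c 4) + 1680 * w * (384 * e 4)" by algebra
    also have "\<dots> = 3225600 + 1587600 * w" unfolding c4 e4 by simp
    finally show ?thesis .
  qed
  have t5: "645120 * (c 5 + w * e 5) = - 3870720 - 1746360 * w"
  proof -
    have "645120 * (c 5 + w * e 5) = 168 * (3840 * c 5) + 168 * w * (3840 * e 5)" by algebra
    also have "\<dots> = - 3870720 - 1746360 * w" unfolding c5 e5 by simp
    finally show ?thesis .
  qed
  have t6: "645120 * (c 6 + w * e 6) = 4515840 + 1891890 * w"
  proof -
    have "645120 * (c 6 + w * e 6) = 14 * (46080 * c 6) + 14 * w * (46080 * e 6)" by algebra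
    also have "\<dots> = 4515840 + 1891890 * w" unfolding c6 e6 by simp
    finally show ?thesis .
  qed
  have t7: "645120 * (c 7 + w * e 7) = - 5160960 - 2027025 * w"
  proof -
    have "645120 * (c 7 + w * e 7) = 1 * (645120 * c 7) + 1 * w * (645120 * e 7)" by algebra
    also have "\<dots> = - 5160960 - 2027025 * w" unfolding c7 e7 by simp
    finally show ?thesis .
  qed
  have u: "1 - w\<^sup>2 = 6 - 2 * w" "- w\<^sup>2 = 5 - 2 * w" unfolding w by simp_all
  have p0: "(1 - w\<^sup>2) ^ 0 * (- w\<^sup>2) ^ 7 = 84505 - 8062 * w" unfolding u using w by algebra
  have p1: "(1 - w\<^sup>2) ^ 1 * (- w\<^sup>2) ^ 6 = 91110 - 2914 * w" unfolding u using w by algebra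
  have p2: "(1 - w\<^sup>2) ^ 2 * (- w\<^sup>2) ^ 5 = 95920 + 3792 * w" unfolding u using w by algebra
  have p3: "(1 - w\<^sup>2) ^ 3 * (- w\<^sup>2) ^ 4 = 98240 + 12224 * w" unfolding u using w by algebra
  have p4: "(1 - w\<^sup>2) ^ 4 * (- w\<^sup>2) ^ 3 = 97280 + 22528 * w" unfolding u using w by algebra
  have p5: "(1 - w\<^sup>2) ^ 5 * (- w\<^sup>2) ^ 2 = 92160 + 34816 * w" unfolding u using w by algebra
  have p6: "(1 - w\<^sup>2) ^ 6 * (- w\<^sup>2) ^ 1 = 81920 + 49152 * w" unfolding u using w by algebra
  have p7: "(1 - w\<^sup>2) ^ 7 * (- w\<^sup>2) ^ 0 = 65536 + 65536 * w" unfolding u using w by algebra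
  have "hermite_sum w m 7 N = 1 * ((1 - w\<^sup>2) ^ 0 * (- w\<^sup>2) ^ 7) * (c 0 + w * e 0) + 7 * ((1 - w\<^sup>2) ^ 1 * (- w\<^sup>2) ^ 6) * (c 1 + w * e 1) + 21 * ((1 - w\<^sup>2) ^ 2 * (- w\<^sup>2) ^ 5) * (c 2 + w * e 2) + 35 * ((1 - w\<^sup>2) ^ 3 * (- w\<^sup>2) ^ 4) * (c 3 + w * e 3) + 35 * ((1 - w\<^sup>2) ^ 4 * (- w\<^sup>2) ^ 3) * (c 4 + w * e 4) + 21 * ((1 - w\<^sup>2) ^ 5 * (- w\<^sup>2) ^ 2) * (c 5 + w * e 5) + 7 * ((1 - w\<^sup>2) ^ 6 * (- w\<^sup>2) ^ 1) * (c 6 + w * e 6) + 1 * ((1 - w\<^sup>2) ^ 7 * (- w\<^sup>2) ^ 0) * (c 7 + w * e 7)"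
    unfolding hermite_sum_def c_def e_def by (simp add: eval_nat_numeral mult.assoc)
  note sum = this[unfolded p0 p1 p2 p3 p4 p5 p6 p7]
  have "2 ^ 15 * 3 ^ 2 * 5 ^ 1 * 7 ^ 1 * (- 73 - 41 * w) = 1 * (84505 - 8062 * w) * (645120 + 645120 * w) + 7 * (91110 - 2914 * w) * (- 1290240 - 967680 * w) + 21 * (95920 + 3792 * w) * (1935360 + 1209600 * w) + 35 * (98240 + 12224 * w) * (- 2580480 - 1411200 * w) + 35 * (97280 + 22528 * w) * (3225600 + 1587600 * w) + 21 * (92160 + 34816 * w) * (- 3870720 - 1746360 * w) + 7 * (81920 + 49152 * w) * (4515840 + 1891890 * w) + 1 * (65536 + 65536 * w) * (- 5160960 - 2027025 * w)"
    using w by algebra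
  also have "\<dots> = 1 * (84505 - 8062 * w) * (645120 * (c 0 + w * e 0)) + 7 * (91110 - 2914 * w) * (645120 * (c 1 + w * e 1)) + 21 * (95920 + 3792 * w) * (645120 * (c 2 + w * e 2)) + 35 * (98240 + 12224 * w) * (645120 * (c 3 + w * e 3)) + 35 * (97280 + 22528 * w) * (645120 * (c 4 + w * e 4)) + 21 * (92160 + 34816 * w) * (645120 * (c 5 + w * e 5)) + 7 * (81920 + 49152 * w) * (645120 * (c 6 + w * e 6)) + 1 * (65536 + 65536 * w) * (645120 * (c 7 + w * e 7))"
    unfolding t0 t1 t2 t3 t4 t5 t6 t7 ..
  also have "\<dots> = 645120 * hermite_sum w m 7 N" unfolding sum by algebra
  also have "\<dots> = 0" unfolding H by simp
  finally have "- 73 - 41 * w = 0"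
    using nz by (simp only: mult_eq_0_iff power_eq_0_iff simp_thms)
  then show ?thesis by algebra
qed

section \<open>Characteristic 3\<close>

lemma hermite_sum_3_eq_0_char_3:
  fixes w :: "'a::field"
  assumes 3: "(3::'a) = 0" and H: "hermite_sum w m 3 N = 0"
  shows "(1 - w ^ 6) * (of_nat (N choose 3) + w * of_nat ((N + m) choose 3)) = w ^ 6 * (1 + w)"
proof -
  have "hermite_sum w m 3 N = (- w\<^sup>2) ^ 3 * (1 + w) + 3 * (1 - w\<^sup>2) * (- w\<^sup>2)\<^sup>2 * (of_nat N + w * of_nat (N + m))
      + 3 * (1 - w\<^sup>2)\<^sup>2 * (- w\<^sup>2) * (of_nat (N choose 2) + w * of_nat ((N + m) choose 2))
      + (1 - w\<^sup>2) ^ 3 * (of_nat (N choose 3) + w * of_nat ((N + m) choose 3))"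
    unfolding hermite_sum_def by (simp add: eval_nat_numeral)
  then have "(1 - w\<^sup>2) ^ 3 * (of_nat (N choose 3) + w * of_nat ((N + m) choose 3)) = w ^ 6 * (1 + w)"
    unfolding H 3 by simp
  moreover have "(1 - w\<^sup>2) ^ 3 = 1 - w ^ 6 + 3 * (w ^ 4 - w\<^sup>2)" by algebra
  ultimately show ?thesis unfolding 3 by simp
qed

text \<open>The case \<open>n = 4\<close>. Binomials with lower index at most 7 depend in
  characteristic 3 only on the upper index modulo 9, so the sum is an explicit polynomial in
  \<open>w\<close>.\<close>

lemma hermite_sum_7_neq_0_char_3:
  fixes w :: "'a::field"
  assumes 3: "(3::'a) = 0" and w: "w\<^sup>2 = 1 - w" and N: "N = 7 + 9 * t" and M: "N + m = 3 + 9 * s"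
  shows "hermite_sum w m 7 N \<noteq> 0"
proof
  assume H: "hermite_sum w m 7 N = 0"
  have p: "prime (3::nat)" "of_nat 3 = (0::'a)" using 3 by simp_all
  have "of_nat ((7 + 9 * t) choose j) = (of_nat (7 choose j) :: 'a)"
     "of_nat ((3 + 9 * s) choose j) = (of_nat (3 choose j) :: 'a)" if "j \<le> 7" for j
    using of_nat_choose_add_prime_power_mult[OF p, of j 2] that by simp_all
  then have "hermite_sum w m 7 N = (\<Sum>j\<le>7. of_nat (7 choose j) * (1 - w\<^sup>2) ^ j * (- w\<^sup>2) ^ (7 - j)
    * (of_nat (7 choose j) + w * of_nat (3 choose j)))"
    unfolding hermite_sum_def M unfolding N by (intro sum.cong) auto
  also have "\<dots> = (- w\<^sup>2) ^ 7 * (1 + w) + 7 * (1 - w\<^sup>2) * (- w\<^sup>2) ^ 6 * (7 + w * 3)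
    + 21 * (1 - w\<^sup>2)\<^sup>2 * (- w\<^sup>2) ^ 5 * (21 + w * 3) + 35 * (1 - w\<^sup>2) ^ 3 * (- w\<^sup>2) ^ 4 * (35 + w)
    + 35 * (1 - w\<^sup>2) ^ 4 * (- w\<^sup>2) ^ 3 * 35 + 21 * (1 - w\<^sup>2) ^ 5 * (- w\<^sup>2)\<^sup>2 * 21
    + 7 * (1 - w\<^sup>2) ^ 6 * (- w\<^sup>2) * 7 + (1 - w\<^sup>2) ^ 7"
    by (simp add: eval_nat_numeral)
  \<comment> \<open>Modulo \<open>w^2 = 1 - w\<close> the vanishing sum gives a linear relation with
    integer coefficients; apart from multiples of 3 it is \<open>w - 1 = 0\<close>, and
    \<open>w = 1\<close> violates the quadratic.\<close>
  finally have "3 * (79829 * w - 49337) + (w - 1) = 0" unfolding H using w by algebra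
  then have "w = 1" unfolding 3 by simp
  then show False using w by simp
qed

section \<open>The case \<open>r = 3\<close> modulo \<open>p\<close>\<close>

lemma of_nat_power_prime_power:
  assumes "prime p" "of_nat p = (0::'a::comm_semiring_1)"
  shows "(of_nat n :: 'a) ^ (p ^ e) = of_nat n"
proof (induction n)
  case 0
  then show ?case using prime_gt_0_nat[OF assms(1)] by (simp add: zero_power)
next
  case (Suc n)
  then show ?case using freshman_dream[OF assms, of 1 "of_nat n" e] by simp
qed

text \<open>For \<open>d = p ^ e\<close> the inner binomial coefficients of \<open>d\<close> vanish
  in characteristic \<open>p\<close>, so only the terms \<open>j = 0\<close> and
  \<open>j = d\<close> survive.\<close>

lemma hermite_sum_prime_power_eq_0:
  fixes w :: "'a::field"
  assumes p: "prime p" "odd p" "of_nat p = (0::'a)" and H: "hermite_sum w m (p ^ e) N = 0"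
  shows "(1 - w\<^sup>2) ^ (p ^ e) * (of_nat (N choose (p ^ e)) + w * of_nat ((N + m) choose (p ^ e)))
    = (w\<^sup>2) ^ (p ^ e) * (1 + w)"
proof -
  let ?P = "p ^ e"
  let ?g = "\<lambda>j. of_nat (?P choose j) * (1 - w\<^sup>2) ^ j * (- w\<^sup>2) ^ (?P - j)
    * (of_nat (N choose j) + w * of_nat ((N + m) choose j))"
  have P: "?P > 0" "odd ?P" using p prime_gt_0_nat by auto
  have mid: "of_nat (?P choose j) = (0::'a)" if "0 < j" "j < ?P" for j
    using of_nat_choose_add_prime_power_mult[OF p(1,3) that(2), of 0 1] that by (simp add: binomial_eq_0)
  have "hermite_sum w m ?P N = (\<Sum>j\<in>{0, ?P}. ?g j)"
    unfolding hermite_sum_def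
  proof (rule sum.mono_neutral_right)
    show "\<forall>j\<in>{..?P} - {0, ?P}. ?g j = 0"
    proof
      fix j assume "j \<in> {..?P} - {0, ?P}"
      then have "0 < j" "j < ?P" by auto
      then show "?g j = 0" using mid[of j] by simp
    qed
  qed auto
  also have "\<dots> = ?g 0 + ?g ?P" using P(1) by simp
  also have "?g 0 = - ((w\<^sup>2) ^ ?P * (1 + w))" using P(2) by simp
  finally have "?g ?P = (w\<^sup>2) ^ ?P * (1 + w)"
    unfolding H eq_commute[of 0] add_eq_0_iff by simp
  then show ?thesis by simp
qed

text \<open>With \<open>n = (p ^ e + 1)/2\<close> one has \<open>d = p ^ e\<close>. The two
  remaining binomials become \<open>u\<close> and \<open>1 + u - 1/2\<close>; at
  \<open>w = 1/3\<close> the parts free of \<open>u\<close> cancel, which leaves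
  \<open>u = 0\<close>.\<close>

lemma not_hermite_sum_prime_power_eq_0:
  fixes w :: "'a::field"
  assumes p: "prime p" "p > 3" "of_nat p = (0::'a)" and e: "e > 0" "e < k"
    and w: "3 * w = 1" and u: "of_nat u \<noteq> (0::'a)"
    and r: "r = 3 + p ^ e * (2 * u)" and m: "2 * m = p ^ k + 1"
  shows "hermite_sum w m (p ^ e) ((p ^ e + 1) div 2 * (r - 2) - 1) \<noteq> 0"
proof
  let ?P = "p ^ e"
  let ?N = "(?P + 1) div 2 * (r - 2) - 1"
  assume H: "hermite_sum w m ?P ?N = 0"
  have oddp: "odd p" using prime_odd_nat[OF p(1)] p(2) by simp
  have "odd ?P" using oddp by simp
  then obtain h where h: "?P = 2 * h + 1" by (rule oddE)
  have "odd (p ^ (k - e))" using oddp by simp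
  then obtain l where l: "p ^ (k - e) = 2 * l + 1" by (rule oddE)
  have pk: "p ^ k = ?P * (2 * l + 1)" unfolding l[symmetric] using e by (simp flip: power_add)
  have P0: "of_nat ?P = (0::'a)" using p e by simp
  have "of_nat (2 * l + 1) = (0::'a)" unfolding l[symmetric] using p e by simp
  then have l0: "2 * of_nat l = (- 1 :: 'a)" by (simp add: eq_neg_iff_add_eq_0 add.commute)
  \<comment> \<open>Modulo \<open>?P\<close> the remainders of \<open>?N\<close> and
    \<open>m\<close> are \<open>h\<close> and \<open>h + 1\<close>; their sum carries, so
    \<open>?N + m\<close> is a multiple of \<open>?P\<close>.\<close>
  have N: "?N = h + ?P * (u * (?P + 1))"
  proof -
    have "(?P + 1) div 2 * (r - 2) = Suc h * (1 + ?P * (2 * u))" unfolding r by (simp add: h)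
    also have "\<dots> = Suc h + ?P * (u * (2 * h + 2))" by (simp add: algebra_simps)
    also have "2 * h + 2 = ?P + 1" using h by simp
    finally show ?thesis by simp
  qed
  have NM: "?N + m = 0 + ?P * (1 + u * (?P + 1) + l)"
  proof -
    have "m = h + 1 + ?P * l" using m unfolding pk by (simp add: algebra_simps h)
    then show ?thesis unfolding N by (simp add: algebra_simps h)
  qed
  have hP: "h < ?P" and P1: "0 < ?P" using h by simp_all
  have uP: "of_nat (u * (?P + 1)) = (of_nat u :: 'a)"
    by (simp only: of_nat_mult of_nat_add P0 of_nat_1 add_0 mult_1_right)
  have "of_nat (?N choose ?P) = (of_nat u :: 'a)"
    unfolding N of_nat_choose_prime_power[OF p(1,3) hP] by (rule uP)
  moreover have "of_nat ((?N + m) choose ?P) = (1 + of_nat u + of_nat l :: 'a)"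
    unfolding NM of_nat_choose_prime_power[OF p(1,3) P1] by (simp only: of_nat_add uP of_nat_1)
  \<comment> \<open>\<open>w = 1/3\<close> lies in the prime field, which the Frobenius map
    fixes.\<close>
  moreover have "(w\<^sup>2) ^ ?P = w\<^sup>2" "(1 - w\<^sup>2) ^ ?P = 1 - w\<^sup>2"
  proof -
    have "(3::'a) \<noteq> 0" using w by auto
    moreover have "(9::'a) = 3 * 3" by simp
    ultimately have "(9::'a) \<noteq> 0" by (simp only: mult_eq_0_iff simp_thms)
    from \<open>3 \<noteq> 0\<close> have w: "w = 1 / of_nat 3" using w by (simp add: eq_divide_eq mult.commute)
    have w2: "w\<^sup>2 = 1 / of_nat 9" "1 - w\<^sup>2 = of_nat 8 / of_nat 9"
      using \<open>3 \<noteq> 0\<close> \<open>9 \<noteq> 0\<close> unfolding w by (simp_all add: power2_eq_square field_simps)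
    show "(w\<^sup>2) ^ ?P = w\<^sup>2"
      unfolding w2(1) by (simp only: power_divide of_nat_power_prime_power[OF p(1,3)] power_one)
    show "(1 - w\<^sup>2) ^ ?P = 1 - w\<^sup>2"
      unfolding w2(2) by (simp only: power_divide of_nat_power_prime_power[OF p(1,3)])
  qed
  ultimately have "(1 - w\<^sup>2) * (of_nat u + w * (1 + of_nat u + of_nat l)) = w\<^sup>2 * (1 + w)"
    using hermite_sum_prime_power_eq_0[OF p(1) oddp p(3) H] by simp
  then have "(1 - w\<^sup>2) * (of_nat u + w * (1 + of_nat u + of_nat l)) - w\<^sup>2 * (1 + w) = 0" by simp
  \<comment> \<open>The factor 54, a multiple of \<open>3^3\<close>, clears the denominators of
    \<open>w = 1/3\<close>. Besides \<open>64 * v\<close> there remains a multiple of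
    \<open>2 * x + 1\<close>, which vanishes at the image of \<open>l\<close>.\<close>
  moreover have "54 * ((1 - w\<^sup>2) * (v + w * (1 + v + x)) - w\<^sup>2 * (1 + w))
      = 2 * (9 - (3 * w)\<^sup>2) * (3 * v + (3 * w) * (1 + v + x)) - 2 * (3 * w)\<^sup>2 * (3 + 3 * w)" for v x
    by algebra
  then have *: "54 * ((1 - w\<^sup>2) * (v + w * (1 + v + x)) - w\<^sup>2 * (1 + w)) = 64 * v + 8 * (2 * x + 1)" for v x
    unfolding w by simp
  ultimately have "64 * of_nat u + 8 * (2 * of_nat l + 1) = (0::'a)"
    using *[of "of_nat u" "of_nat l"] by (simp only: mult_zero_right)
  then have "2 ^ 6 * of_nat u = (0::'a)" unfolding l0 by simp
  moreover have "(2::'a) \<noteq> 0"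
  proof
    assume "(2::'a) = 0"
    then have "of_nat 1 = (0::'a)" using l0 by simp
    then show False by simp
  qed
  ultimately show False using u by (simp only: mult_eq_0_iff power_eq_0_iff simp_thms)
qed

text \<open>The equation for \<open>n = 1\<close> gives a quadratic for \<open>w\<close> that
  depends on \<open>r\<close> modulo 3, and \<open>n = 2\<close> then restricts
  \<open>r div 3\<close> modulo 3. If \<open>r = 2\<close> modulo 3 this is already contradictory;
  if \<open>r = 1\<close> it forces \<open>r = 4\<close> modulo 9, which \<open>n = 4\<close>
  excludes.\<close>

lemma hermite_sums_neq_0_char_3:
  fixes w :: "'a::field"
  assumes char: "CHAR('a) = 3" and t: "m = 5 + 9 * t" and r5: "r \<ge> 5" and r0: "r mod 3 \<noteq> 0"
    and w: "w\<^sup>2 \<noteq> 1" and E1: "2 * (1 - w\<^sup>2) * (of_nat r - 3) = w * (3 * w - 1)"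
    and H3: "hermite_sum w m 3 (2 * (r - 2) - 1) = 0"
    and H7: "hermite_sum w m 7 (4 * (r - 2) - 1) = 0"
  shows False
proof -
  have 3: "(3::'a) = 0" using of_nat_CHAR[where 'a = 'a] unfolding char by simp
  have p3: "prime (3::nat)" "of_nat 3 = (0::'a)" using 3 by simp_all
  note char3 = hermite_sum_3_eq_0_char_3[OF 3 H3]
  have choose3: "of_nat ((i + 3 * j) choose 3) = (of_nat j :: 'a)" if "i < 3" for i j
    using of_nat_choose_prime_power[OF p3, of i 1 j] that by simp
  have w1: "w \<noteq> 1" "w \<noteq> - 1" using w by auto
  have "r = 3 * (r div 3) + 1 \<or> r = 3 * (r div 3) + 2" using r0 by presburger
  then consider "r = 3 * (r div 3) + 1" | "r = 3 * (r div 3) + 2" by blast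
  then show False
  proof cases
    case 1
    define u where "u = r div 3"
    have r: "r = 3 * u + 1" "u \<ge> 1" using 1 r5 unfolding u_def by linarith+
    have "2 * (1 - w\<^sup>2) * (1 - 3) = w * (3 * w - 1)" using E1 unfolding r(1) by (simp add: 3)
    then have "w\<^sup>2 = 1 - w + 3" by algebra
    then have w2: "w\<^sup>2 = 1 - w" unfolding 3 by simp
    have N: "2 * (r - 2) - 1 = 0 + 3 * (2 * u - 1)" using r by simp
    have M: "2 * (r - 2) - 1 + m = 2 + 3 * (2 * u + 3 * t)" unfolding t using r by simp
    have "of_nat (2 * (r - 2) - 1 choose 3) = (2 * of_nat u - 1 :: 'a)"
      unfolding N by (subst choose3) (use r in \<open>simp_all add: of_nat_diff\<close>)
    moreover have "of_nat (2 * (r - 2) - 1 + m choose 3) = (2 * of_nat u :: 'a)"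
      unfolding M by (subst choose3) (simp_all add: 3)
    ultimately have "(1 - w ^ 6) * (2 * of_nat u - 1 + w * (2 * of_nat u)) = w ^ 6 * (1 + w)"
      using char3 by simp
    moreover have w6: "w ^ 6 = 5 - 8 * w" using w2 by algebra
    ultimately have "(1 - (5 - 8 * w)) * (2 * of_nat u - 1 + w * (2 * of_nat u)) = (5 - 8 * w) * (1 + w)"
      by simp
    \<comment> \<open>The reduction modulo the quadratic has integer coefficients; the multiples of
      3 are kept apart and then dropped.\<close>
    then have "(w - 1) * (of_nat u - 1)
        + 3 * (3 * of_nat u - 3 * w * of_nat u + 2 - 4 * w) = 0"
      using w2 by algebra
    then have "of_nat u = (of_nat 1 :: 'a)" unfolding 3 using w1 by simp
    then have "[u = 1] (mod 3)" unfolding of_nat_eq_iff_cong_CHAR char .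
    then have "3 dvd u - 1" using r(2) by (simp add: cong_altdef_nat)
    then obtain v where "u - 1 = 3 * v" by blast
    then have "u = 1 + 3 * v" using r(2) by simp
    then have r: "r = 4 + 9 * v" using r by simp
    have "4 * (r - 2) - 1 = 7 + 9 * (4 * v)"
      "4 * (r - 2) - 1 + m = 3 + 9 * (1 + 4 * v + t)" unfolding t using r by simp_all
    then show False using hermite_sum_7_neq_0_char_3[OF 3 w2] H7 by blast
  next
    case 2
    define u where "u = r div 3"
    have r: "r = 3 * u + 2" "u \<ge> 1" using 2 r5 unfolding u_def by linarith+
    have "2 * (1 - w\<^sup>2) * (2 - 3) = w * (3 * w - 1)" using E1 unfolding r(1) by (simp add: 3)
    then have "w\<^sup>2 = 1 + w - 3" by algebra
    then have w2: "w\<^sup>2 = 1 + w" unfolding 3 by simp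
    have N: "2 * (r - 2) - 1 = 2 + 3 * (2 * u - 1)" using r by simp
    have M: "2 * (r - 2) - 1 + m = 1 + 3 * (2 * u + 1 + 3 * t)" unfolding t using r by simp
    have "of_nat (2 * (r - 2) - 1 choose 3) = (2 * of_nat u - 1 :: 'a)"
      unfolding N by (subst choose3) (use r in \<open>simp_all add: of_nat_diff\<close>)
    moreover have "of_nat (2 * (r - 2) - 1 + m choose 3) = (2 * of_nat u + 1 :: 'a)"
      unfolding M by (subst choose3) (simp_all add: 3)
    ultimately have "(1 - w ^ 6) * (2 * of_nat u - 1 + w * (2 * of_nat u + 1)) = w ^ 6 * (1 + w)"
      using char3 by simp
    moreover have w6: "w ^ 6 = 8 * w + 5" using w2 by algebra
    ultimately have "(1 - (8 * w + 5)) * (2 * of_nat u - 1 + w * (2 * of_nat u + 1)) = (8 * w + 5) * (1 + w)"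
      by simp
    then have "w * (of_nat u + 1) - 1
        + 3 * (13 * w * of_nat u + 8 * of_nat u + 8 * w + 6) = 0"
      using w2 by algebra
    then have wu: "w * (of_nat u + 1) = 1" unfolding 3 by simp
    \<comment> \<open>In the field \<open>u + 1\<close> is 1, -1 or 0, so \<open>w\<close> would be
      1 or -1, or else 0 would equal 1.\<close>
    define v where "v = u div 3"
    have "u = 3 * v \<or> u = 3 * v + 1 \<or> u = 3 * v + 2" unfolding v_def by presburger
    then have "of_nat u = (0::'a) \<or> of_nat u = (1::'a) \<or> of_nat u = (2::'a)"
      by (auto simp: 3)
    then consider "of_nat u + 1 = (1::'a)" | "of_nat u + 1 = (3 - 1 :: 'a)" | "of_nat u + 1 = (3::'a)" by auto
    then show False
    proof cases
      case 1 with wu w1(1) show False by simp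
    next
      case 2 with wu have "- w = 1" unfolding 3 by simp
      then show False using w1(2) by (metis minus_minus)
    next
      case 3 with wu \<open>(3::'a) = 0\<close> show False by simp
    qed
  qed
qed

subsection \<open>The theorem\<close>

theorem theorem2p1:
  fixes p q k r :: nat
    and a :: "'a::{field, finite}"
    and f :: "'a poly"
  assumes "prime p" and "odd p" and "k \<ge> 1" and "q = p ^ k"
    and "CARD('a) = q ^ 2"
    and "odd r" and "r > 3"
    and "a \<noteq> 0" and "a ^ (q + 1) \<noteq> 1"
    and "f = monom 1 r * ([:a:] + monom 1 (2 * (q - 1)))"
    and "[r = 3] (mod p) \<Longrightarrow> int q \<ge> int r ^ 2 - 4 * int r + 5"
    and "\<not> [r = 3] (mod p) \<Longrightarrow> p = 3 \<or> [4 * r = 7] (mod p) \<Longrightarrow> int q \<ge> 8 * int r - 15"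
    and "p > 3 \<Longrightarrow> \<not> [r = 3] (mod p) \<Longrightarrow> \<not> [4 * r = 7] (mod p) \<Longrightarrow> int q \<ge> 6 * int r - 11"
  shows "\<not> permutation_polynomial f"
proof
  assume "permutation_polynomial f"
  then have bij: "bij (poly (monom 1 r * ([:a:] + monom 1 (2 * (q - 1)))))"
    unfolding permutation_polynomial_def assms(10) .
  note p = assms(1,2) and q = assms(4) and r = assms(6,7) and a = assms(8,9)
  define m where "m = (q + 1) div 2"
  define w where "w = (- a) ^ m"
  have "odd q" using p q by simp
  then have m2: "2 * m = q + 1" unfolding m_def by simp
  have p0: "of_nat p = (0::'a)"
    using of_nat_CARD_eq_0[where 'a = 'a] assms(4,5) by simp
  have q0: "of_nat q = (0::'a)" using p0 assms(3,4) by simp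
  have m: "2 * of_nat m = (1::'a)"
    using arg_cong[OF m2, of "of_nat :: nat \<Rightarrow> 'a"] q0 by simp
  have "w\<^sup>2 = a ^ (q + 1)"
    unfolding w_def by (simp flip: power_mult add: mult.commute[of m] m2) (simp add: \<open>odd q\<close>)
  then have w: "w \<noteq> 0" "w\<^sup>2 \<noteq> 1" using a by (auto simp: w_def)
  have H: "hermite_sum w m (2 * n - 1) (n * (r - 2) - 1) = 0" if "n > 0" "2 * (n * (r - 2)) \<le> q" for n
    using hermite_sum_eq_0[OF p q assms(5) r(2) a bij that m_def w_def refl refl] .

  have "CHAR('a) = p"
  proof -
    have "CHAR('a) dvd p" using p0 by (simp add: of_nat_eq_0_iff_char_dvd)
    then show ?thesis using p(1) by (metis CHAR_not_1' One_nat_def prime_nat_iff)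
  qed
  then have of_nat_0: "of_nat n = (0::'a) \<longleftrightarrow> p dvd n"
    and of_nat_eq: "of_nat n = (of_nat n' :: 'a) \<longleftrightarrow> [n = n'] (mod p)" for n n'
    by (simp_all add: of_nat_eq_0_iff_char_dvd of_nat_eq_iff_cong_CHAR)
  have two: "(2::'a) \<noteq> 0" using m by auto
  have three: "(3::'a) \<noteq> 0" if "p > 3"
    using of_nat_0[of 3] that by (auto dest: dvd_imp_le)

  \<comment> \<open>The linear bounds are \<open>6 (r - 2) + 1\<close> and
    \<open>8 (r - 2) + 1\<close>: they admit \<open>n = 3\<close> and \<open>n = 4\<close> in
    \<open>H\<close>. The weaker one holds whenever \<open>r\<close> is not 3 modulo
    \<open>p\<close>.\<close>
  have bound: "q \<ge> 6 * r - 11" if "\<not> [r = 3] (mod p)"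
  proof (cases "p = 3 \<or> [4 * r = 7] (mod p)")
    case True
    then show ?thesis using assms(12)[OF that] r(2) by linarith
  next
    case False
    moreover have "p \<ge> 3" using p prime_ge_2_nat[OF p(1)] by (cases "p = 2") auto
    ultimately show ?thesis using assms(13)[OF _ that] r(2) by linarith
  qed
  have sq: "q \<ge> (r - 2)\<^sup>2 + 1" if "[r = 3] (mod p)"
  proof -
    have "int ((r - 2)\<^sup>2 + 1) = int r ^ 2 - 4 * int r + 5"
    proof -
      have "int (r - 2) = int r - 2" using r(2) by simp
      then have "int ((r - 2)\<^sup>2 + 1) = (int r - 2)\<^sup>2 + 1" by simp
      then show ?thesis by algebra
    qed
    then show ?thesis using assms(11)[OF that] by linarith
  qed
  have "2 * (r - 2) \<le> q"
  proof (cases "[r = 3] (mod p)")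
    case True
    have "2 * (r - 2) \<le> (r - 2)\<^sup>2" using r(2) by (simp add: power2_eq_square)
    then show ?thesis using sq[OF True] by linarith
  next
    case False
    then show ?thesis using bound r(2) by linarith
  qed
  then have "hermite_sum w m 1 (r - 3) = 0" using H[of 1] by simp
  then have E1: "2 * (1 - w\<^sup>2) * (of_nat r - 3) = w * (3 * w - 1)"
    using hermite_sum_1_eq_0[OF m w(2), of "r - 3"] r(2) by (simp add: of_nat_diff)
  have w3: "3 * w = 1" if "[r = 3] (mod p)"
    using E1 w(1) that of_nat_eq[of r 3] by simp

  show False
  proof (cases "[r = 3] (mod p)")
    case True
    have p3: "p > 3"
    proof -
      have "p \<noteq> 3" using w3[OF True] p0 by auto
      moreover have "p \<noteq> 2" using p by auto
      ultimately show ?thesis using prime_ge_2_nat[OF p(1)] by linarith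
    qed
    \<comment> \<open>This yields \<open>r = 3 + p^e * 2u\<close> with \<open>p\<close> not dividing
      \<open>u\<close>; the factor 2 is available because \<open>r\<close> is odd.\<close>
    define e where "e = multiplicity p (r - 3)"
    obtain v where v: "r - 3 = p ^ e * v" "\<not> p dvd v"
      by (rule multiplicity_decompose'[of "r - 3" p])
         (use r(2) p(1) prime_gt_1_nat in \<open>auto simp: e_def\<close>)
    have "even (r - 3)" using r by simp
    then have "even v" using p v(1) by simp
    then obtain u where u: "v = 2 * u" by blast
    have "p dvd r - 3" using True r(2) by (simp add: cong_altdef_nat)
    then have e0: "e > 0" using v by (intro Nat.gr0I) auto
    have v0: "v > 0" using v(2) by (intro Nat.gr0I) auto
    then have "p ^ e * 1 \<le> p ^ e * v" by (intro mult_le_mono) auto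
    then have Pr: "p ^ e \<le> r - 3" using v(1) by simp
    have "r - 2 \<le> (r - 2)\<^sup>2" by (rule self_le_power) (use r(2) in auto)
    then have "p ^ e < p ^ k" using sq[OF True] Pr unfolding q by linarith
    then have ek: "e < k" using p(1) by (metis prime_gt_1_nat power_less_imp_less_exp)
    define n where "n = (p ^ e + 1) div 2"
    have n: "2 * n = p ^ e + 1" unfolding n_def using p by simp
    \<comment> \<open>Since \<open>p ^ e \<le> r - 3\<close>, the exponent \<open>2 * n\<close> is
      at most \<open>r - 2\<close>, so the quadratic bound on \<open>q\<close> admits this
      \<open>n\<close>.\<close>
    have "2 * (n * (r - 2)) = (p ^ e + 1) * (r - 2)" unfolding n[symmetric] by simp
    also have "\<dots> \<le> (r - 2) * (r - 2)" using Pr r(2) by (intro mult_le_mono) auto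
    also have "\<dots> \<le> q" using sq[OF True] by (simp add: power2_eq_square)
    finally have "hermite_sum w m (2 * n - 1) (n * (r - 2) - 1) = 0" using n by (intro H) auto
    then have "hermite_sum w m (p ^ e) ((p ^ e + 1) div 2 * (r - 2) - 1) = 0"
      unfolding n by (simp add: n_def)
    moreover have "of_nat u \<noteq> (0::'a)" using v(2) unfolding u of_nat_0 by auto
    moreover have "r = 3 + p ^ e * (2 * u)" using v(1) r(2) unfolding u by simp
    ultimately show False
      using not_hermite_sum_prime_power_eq_0[OF p(1) p3 p0 e0 ek w3[OF True]] m2 q by simp
  next
    case False
    note r3 = this
    have "2 * (2 * (r - 2)) \<le> q" using bound[OF r3] r(2) by linarith
    then have H3: "hermite_sum w m 3 (2 * (r - 2) - 1) = 0" using H[of 2] by simp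
    show False
    proof (cases "p = 3")
      case True
      have r5: "r \<ge> 5" using r by presburger
      moreover have "q \<ge> 8 * r - 15" using assms(12)[OF r3] True r(2) by simp
      ultimately have q8: "q \<ge> 25" "8 * (r - 2) \<le> q" by linarith+
      \<comment> \<open>A power of 3 that is at least 25 is an odd multiple of 27, whence
        \<open>m = (q + 1)/2\<close> is 5 modulo 9.\<close>
      have "k \<ge> 3"
      proof (rule ccontr)
        assume "\<not> k \<ge> 3"
        then have "3 ^ k \<le> (3::nat) ^ 2" by (intro power_increasing) auto
        then show False using q8(1) unfolding q True by simp
      qed
      then have "q = 27 * 3 ^ (k - 3)" unfolding q True using power_add[of "3::nat" 3 "k - 3"] by simp
      moreover have "odd (3 ^ (k - 3) :: nat)" by simp
      then obtain l where "3 ^ (k - 3) = 2 * l + (1::nat)" by (rule oddE)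
      ultimately have t: "m = 5 + 9 * (1 + 3 * l)" using m2 by simp
      have "r mod 3 \<noteq> 0" using r3 True by (auto simp: cong_def)
      moreover have "CHAR('a) = 3" using \<open>CHAR('a) = p\<close> True by simp
      moreover have "hermite_sum w m 7 (4 * (r - 2) - 1) = 0" using H[of 4] q8 by simp
      ultimately show False using hermite_sums_neq_0_char_3[OF _ t r5 _ w(2) E1 H3] by blast
    next
      case False
      then have p3: "p > 3" using p prime_ge_2_nat[OF p(1)] by (cases "p = 2") auto
      note nz = two three[OF p3]
      have N: "(1 - w\<^sup>2) * of_nat (2 * (r - 2) - 1) = 1 - w + 2 * w\<^sup>2"
      proof -
        have "of_nat (2 * (r - 2) - 1) = 2 * (of_nat r - 3 :: 'a) + 1"
          using r(2) by (simp add: of_nat_diff algebra_simps)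
        then show ?thesis using E1 by algebra
      qed
      have "w * (3 * w - 1) * (w\<^sup>2 - 2 * w + 5) * (w\<^sup>2 + 2 * w - 1) = 0"
        by (rule hermite_sum_3_eq_0[OF m w(2) N H3])
      \<comment> \<open>By \<open>E1\<close>, \<open>3 * w = 1\<close> would give
        \<open>r = 3\<close> in the field.\<close>
      moreover have "3 * w - 1 \<noteq> 0"
        using E1 w(2) two r3 of_nat_eq[of r 3] by auto
      ultimately consider "w\<^sup>2 + 2 * w - 1 = 0" | "w\<^sup>2 - 2 * w + 5 = 0" using w(1) by auto
      moreover have "2 * (3 * (r - 2)) \<le> q" using bound[OF r3] r(2) by linarith
      then have H5: "hermite_sum w m 5 (3 * (r - 2) - 1) = 0" using H[of 3] by simp
      moreover have N5: "of_nat (3 * (r - 2) - 1) = 3 * (of_nat r :: 'a) - 7"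
        using r(2) by (simp add: of_nat_diff algebra_simps)
      ultimately show False
      proof cases
        case 1
        then have w2: "w\<^sup>2 = 1 - 2 * w" by algebra
        \<comment> \<open>Here \<open>1 - w^2 = 2 w\<close>, so \<open>E1\<close> may be divided by
          \<open>w\<close>.\<close>
        have "4 * w * of_nat r = w * (3 * w + 11)" using E1 w2 by algebra
        then have "4 * of_nat r = 3 * w + 11" using w(1) by (simp add: mult.assoc mult.left_commute[of 4])
        then have "4 * of_nat (3 * (r - 2) - 1) = 9 * w + 5" unfolding N5 by algebra
        from hermite_sum_5_eq_0_generic[OF w2 m this nz H5] have w29: "29 * w = 12" .
        \<comment> \<open>At \<open>29 * w = 12\<close> the right-hand side is
          \<open>144 + 696 - 841 = -1\<close>, so the quadratic cannot vanish.\<close>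
        have "29\<^sup>2 * (w\<^sup>2 + 2 * w - 1) = (29 * w)\<^sup>2 + 58 * (29 * w) - 841" by algebra
        then show False unfolding 1 w29 by simp
      next
        case 2
        then have w2: "w\<^sup>2 = 2 * w - 5" by algebra
        have "2 * ((1 - w\<^sup>2) * (4 * of_nat r - 7)) = 4 * (2 * (1 - w\<^sup>2) * (of_nat r - 3)) + 10 * (1 - w\<^sup>2)"
          by algebra
        also have "\<dots> = 2 * (w\<^sup>2 - 2 * w + 5)" unfolding E1 by algebra
        finally have "2 * ((1 - w\<^sup>2) * (4 * of_nat r - 7)) = 0" unfolding 2 by simp
        then have r4: "4 * of_nat r = (7::'a)" using two w(2) by simp
        then have r7: "[4 * r = 7] (mod p)" using of_nat_eq[of "4 * r" 7] by simp
        have "p \<noteq> 5"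
        proof
          assume "p = 5"
          then have "[r = 3] (mod p)" using r7 unfolding cong_def by presburger
          then show False using r3 by simp
        qed
        moreover have "p \<noteq> 4" "p \<noteq> 6" using p by auto
        ultimately have "p \<ge> 7" using p3 by linarith
        then have five: "(5::'a) \<noteq> 0" using of_nat_0[of 5] by (auto dest: dvd_imp_le)
        have "4 * (3 * of_nat r - 7) = 3 * (4 * of_nat r) - (28::'a)" by simp
        then have "4 * of_nat (3 * (r - 2) - 1) = (- 7 :: 'a)" unfolding N5 r4 by simp
        from hermite_sum_5_eq_0_exceptional[OF w2 m this nz five H5] have w5: "5 * w = 14" .
        \<comment> \<open>At \<open>5 * w = 14\<close> this is \<open>196 - 140 + 125 = 181\<close>,
          so only characteristic 181 is left.\<close>
        have "5\<^sup>2 * (w\<^sup>2 - 2 * w + 5) = (5 * w)\<^sup>2 - 10 * (5 * w) + 125" by algebra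
        then have n181: "(181::'a) = 0" unfolding 2 w5 by simp
        show False
        proof (cases "p = 7")
          case True
          then have 7: "(7::'a) = 0" using p0 by simp
          have "(181::'a) = 26 * 7 - 1" by simp
          then show False unfolding n181 7 by simp
        next
          case False
          then have seven: "(7::'a) \<noteq> 0" using of_nat_0[of 7] \<open>p \<ge> 7\<close> by (auto dest: dvd_imp_le)
          \<comment> \<open>The congruence \<open>r7\<close> activates the stronger bound
            \<open>8 * r - 15\<close>, which admits \<open>n = 4\<close>.\<close>
          have "2 * (4 * (r - 2)) \<le> q" using assms(12)[OF r3] r7 r(2) by linarith
          then have H7: "hermite_sum w m 7 (4 * (r - 2) - 1) = 0" using H[of 4] by simp
          have "of_nat (4 * (r - 2) - 1) = (4 * of_nat r - 9 :: 'a)"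
            using r(2) by (simp add: of_nat_diff algebra_simps)
          also have "\<dots> = - 2" unfolding r4 by simp
          finally have "41 * w = - 73"
            using hermite_sum_7_eq_0_exceptional[OF w2 m _ nz five seven H7] by blast
          \<comment> \<open>Eliminating \<open>w\<close> from \<open>5 * w = 14\<close> and
            \<open>41 * w = -73\<close> gives \<open>41 * 14 + 5 * 73 = 939 = 0\<close>, but 939 and
            181 are coprime: \<open>16 * 939 - 83 * 181 = 1\<close>.\<close>
          then have "(1::'a) = 16 * (41 * (5 * w) - 5 * (41 * w)) - 83 * 181" unfolding w5 by simp
          also have "41 * (5 * w) - 5 * (41 * w) = 0" by simp
          finally show False unfolding n181 by simp
        qed
      qed
    qed
  qed
qed

end
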